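(* Let $X,Y$ be real Banach spaces and $E,F$ be Banach lattices. (i) For every bounded linear operator $T:X\to F$: if the adjoint $T':F'\to X'$ is limitedly Mwc, then $T$ is limitedly L-weakly compact. (ii) For every bounded linear operator $T:E\to Y$: the adjoint $T':Y'\to E'$ is limitedly L-weakly compact if and only if $T$ is limitedly Mwc.
   Context: $X'$ denotes the norm dual of $X$; the dual of a Banach lattice is a Banach lattice. For a subset $A$ of a Banach lattice, $\mathrm{sol}(A)=\bigcup_{a\in A}[-|a|,|a|]$ is its solid hull. A subset $A$ of a Banach lattice is an Lwc set (L-weakly compact set) if every disjoint sequence in $\mathrm{sol}(A)$ converges to $0$ in norm. A bounded subset $A$ of a Banach space $X$ is limited if every weak$^\ast$-null sequence $(f_n)$ in $X'$ satisfies $\sup_{a\in A}|f_n(a)|\to 0$. A bounded linear operator $T$ from a Banach space to a Banach lattice is limitedly L-weakly compact (l-Lwc) if it maps limited sets to Lwc sets. A bounded linear operator $T$ from a Banach lattice $E$ to a Banach space $Y$ is limitedly Mwc (l-Mwc) if $Tx_n\to 0$ weakly for every disjoint norm-bounded sequence $(x_n)$ in $E$. *)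

theory Defs
  imports "HOL-Analysis.Analysis" "HOL-Library.Lattice_Algebras"
begin

section \<open>Banach lattices\<close>

text \<open>The class \<^class>\<open>lattice_ab_group_add_abs\<close> contributes the lattice operations and
  the law \<open>\<bar>x\<bar> = sup x (- x)\<close>.\<close>

class banach_lattice = banach + ordered_real_vector + lattice_ab_group_add_abs +
  assumes norm_mono_abs: "\<bar>x\<bar> \<le> \<bar>y\<bar> \<Longrightarrow> norm x \<le> norm y"

lemma norm_mono_nonneg:
  fixes x y :: "'a::banach_lattice"
  assumes "0 \<le> x" "x \<le> y"
  shows "norm x \<le> norm y"
  using assms order_trans[OF assms] by (intro norm_mono_abs) (simp only: abs_of_nonneg)

lemma norm_abs:
  fixes x :: "'a::banach_lattice"
  shows "norm \<bar>x\<bar> = norm x"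
  by (intro antisym norm_mono_abs) simp_all

instance real :: banach_lattice
  by standard (auto simp: sup_real_def)

definition disjoint_seq :: "(nat \<Rightarrow> 'a::banach_lattice) \<Rightarrow> bool" where
  "disjoint_seq x \<longleftrightarrow> (\<forall>m n. m \<noteq> n \<longrightarrow> inf \<bar>x m\<bar> \<bar>x n\<bar> = 0)"

definition sol :: "'a::banach_lattice set \<Rightarrow> 'a set" where
  "sol A = (\<Union>a\<in>A. {- \<bar>a\<bar>..\<bar>a\<bar>})"

definition Lwc_set :: "'a::banach_lattice set \<Rightarrow> bool" where
  "Lwc_set A \<longleftrightarrow> (\<forall>x. disjoint_seq x \<and> range x \<subseteq> sol A \<longrightarrow> x \<longlonglongrightarrow> 0)"


section \<open>The norm dual as a Banach space\<close>

text \<open>The dual is a copy of the type of bounded real functionals.  A separate type is needed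
  because the order exists for the codomain \<^typ>\<open>real\<close> only, while a class instance for
  \<^type>\<open>blinfun\<close> would have to cover a whole class of codomains.\<close>

typedef (overloaded) 'a dual = "UNIV :: ('a::real_normed_vector \<Rightarrow>\<^sub>L real) set"
  morphisms blinfun_of_dual dual_of_blinfun ..

setup_lifting type_definition_dual

lift_definition dual_apply :: "'a::real_normed_vector dual \<Rightarrow> 'a \<Rightarrow> real"
  is blinfun_apply .

lemma dual_eqI: "(\<And>x. dual_apply f x = dual_apply g x) \<Longrightarrow> f = g"
  by transfer (rule blinfun_eqI)

instantiation dual :: (real_normed_vector) real_normed_vector
begin

lift_definition norm_dual :: "'a dual \<Rightarrow> real" is norm .
lift_definition zero_dual :: "'a dual" is 0 .
lift_definition plus_dual :: "'a dual \<Rightarrow> 'a dual \<Rightarrow> 'a dual" is "(+)" .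
lift_definition minus_dual :: "'a dual \<Rightarrow> 'a dual \<Rightarrow> 'a dual" is "(-)" .
lift_definition uminus_dual :: "'a dual \<Rightarrow> 'a dual" is uminus .
lift_definition scaleR_dual :: "real \<Rightarrow> 'a dual \<Rightarrow> 'a dual" is "(*\<^sub>R)" .

definition dist_dual :: "'a dual \<Rightarrow> 'a dual \<Rightarrow> real"
  where "dist_dual f g = norm (f - g)"

definition sgn_dual :: "'a dual \<Rightarrow> 'a dual"
  where "sgn_dual f = inverse (norm f) *\<^sub>R f"

definition uniformity_dual :: "('a dual \<times> 'a dual) filter"
  where [code del]:
    "uniformity_dual = (INF e\<in>{0 <..}. principal {(f, g). dist f g < e})"

definition open_dual :: "'a dual set \<Rightarrow> bool"
  where [code del]: "open_dual S = (\<forall>f\<in>S. \<forall>\<^sub>F (f', g) in uniformity. f' = f \<longrightarrow> g \<in> S)"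

instance
  apply standard
  unfolding dist_dual_def open_dual_def sgn_dual_def uniformity_dual_def
  apply (rule refl | (transfer, simp add: norm_triangle_ineq algebra_simps))+
  done

end

lemma dual_apply_simps [simp]:
  "dual_apply 0 x = 0"
  "dual_apply (f + g) x = dual_apply f x + dual_apply g x"
  "dual_apply (f - g) x = dual_apply f x - dual_apply g x"
  "dual_apply (- f) x = - dual_apply f x"
  "dual_apply (c *\<^sub>R f) x = c * dual_apply f x"
  by (transfer, simp only: blinfun.bilinear_simps real_scaleR_def)+

lemma norm_dual_apply: "\<bar>dual_apply f x\<bar> \<le> norm f * norm x"
  by transfer (metis norm_blinfun real_norm_def)

lemma dual_apply_bilinear: "bounded_bilinear dual_apply"
proof
  fix f g :: "'a dual" and x y :: 'a and r :: real
  show "dual_apply (f + g) x = dual_apply f x + dual_apply g x"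
    "dual_apply (r *\<^sub>R f) x = r *\<^sub>R dual_apply f x"
    by simp_all
  show "dual_apply f (x + y) = dual_apply f x + dual_apply f y"
    "dual_apply f (r *\<^sub>R x) = r *\<^sub>R dual_apply f x"
    by (simp_all only: dual_apply.rep_eq blinfun.add_right blinfun.scaleR_right)
  show "\<exists>K. \<forall>f x. norm (dual_apply f x) \<le> norm f * norm x * K"
    by (intro exI[of _ 1]) (simp add: norm_dual_apply)
qed

interpretation dual: bounded_bilinear dual_apply
  by (rule dual_apply_bilinear)

lemma norm_dual_bound:
  "0 \<le> b \<Longrightarrow> (\<And>x. \<bar>dual_apply f x\<bar> \<le> b * norm x) \<Longrightarrow> norm f \<le> b"
  by transfer (auto intro: norm_blinfun_bound)

lemma ex_dual:
  assumes "bounded_linear h"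
  shows "\<exists>f. dual_apply f = h"
  using assms by (metis dual_apply.abs_eq bounded_linear_Blinfun_apply)

instance dual :: (real_normed_vector) banach
proof
  fix X :: "nat \<Rightarrow> 'a dual"
  have dist_eq: "dist f g = dist (blinfun_of_dual f) (blinfun_of_dual g)" for f g :: "'a dual"
    by (simp add: dist_norm norm_dual.rep_eq minus_dual.rep_eq)
  assume "Cauchy X"
  then have "Cauchy (\<lambda>n. blinfun_of_dual (X n))"
    by (simp add: Cauchy_def dist_eq)
  then obtain L where "(\<lambda>n. blinfun_of_dual (X n)) \<longlonglongrightarrow> L"
    using Cauchy_convergent convergent_def by blast
  then have "X \<longlonglongrightarrow> dual_of_blinfun L"
    by (simp add: lim_sequentially dist_eq dual_of_blinfun_inverse)
  then show "convergent X"
    by (auto simp: convergent_def)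
qed


section \<open>The dual of a Banach lattice is a Banach lattice\<close>

lemma riesz_decomposition:
  fixes a b y :: "'a::banach_lattice"
  assumes "0 \<le> a" "0 \<le> b" "0 \<le> y" "y \<le> a + b"
  shows "\<exists>u v. y = u + v \<and> 0 \<le> u \<and> u \<le> a \<and> 0 \<le> v \<and> v \<le> b"
proof (intro exI conjI)
  have eq: "y - inf y a = sup 0 (y - a)"
    by (simp only: diff_inf_eq_sup add_sup_distrib_left add.right_inverse add_uminus_conv_diff)
  show "y = inf y a + (y - inf y a)"
    by (metis add.commute diff_add_cancel)
  show "0 \<le> inf y a" "inf y a \<le> a"
    using assms by (simp_all only: le_inf_iff inf_le2 simp_thms)
  show "0 \<le> y - inf y a" "y - inf y a \<le> b"
    unfolding eq using assms by (simp_all only: sup_ge1 le_sup_iff diff_le_eq add.commute simp_thms)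
qed

text \<open>The Riesz--Kantorovich formula: the positive part of \<open>f\<close> at \<open>x \<ge> 0\<close> is the supremum of
  \<open>f\<close> over the order interval from \<open>0\<close> to \<open>x\<close>.\<close>

lemma ex_pos_part_dual:
  fixes f :: "'a::banach_lattice dual"
  shows "\<exists>p. \<forall>x\<ge>0. (\<forall>y. 0 \<le> y \<and> y \<le> x \<longrightarrow> dual_apply f y \<le> dual_apply p x)
    \<and> (\<forall>c. (\<forall>y. 0 \<le> y \<and> y \<le> x \<longrightarrow> dual_apply f y \<le> c) \<longrightarrow> dual_apply p x \<le> c)"
proof -
  define P where "P x = Sup (dual_apply f ` {0..x})" for x
  have bd: "dual_apply f y \<le> norm f * norm x" if "0 \<le> y" "y \<le> x" for x y
  proof -
    have "dual_apply f y \<le> norm f * norm y"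
      using norm_dual_apply[of f y] by linarith
    also have "\<dots> \<le> norm f * norm x"
      using that by (intro mult_left_mono norm_mono_nonneg) auto
    finally show ?thesis .
  qed
  have upper: "dual_apply f y \<le> P x" if "0 \<le> y" "y \<le> x" for x y
    unfolding P_def using that bd
    by (intro cSUP_upper) (auto intro!: bdd_aboveI[where M = "norm f * norm x"])
  have least: "P x \<le> c" if "0 \<le> x" "\<And>y. 0 \<le> y \<Longrightarrow> y \<le> x \<Longrightarrow> dual_apply f y \<le> c" for x c
    unfolding P_def using that by (intro cSUP_least) auto
  have P_nonneg: "0 \<le> P x" if "0 \<le> x" for x
    using upper[of 0 x] that by (simp add: dual.zero_right)
  have P_add: "P (a + b) = P a + P b" if ab: "0 \<le> a" "0 \<le> b" for a b
  proof (rule antisym)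
    show "P (a + b) \<le> P a + P b"
    proof (rule least)
      fix y assume "0 \<le> y" "y \<le> a + b"
      then obtain u v where "y = u + v" "0 \<le> u" "u \<le> a" "0 \<le> v" "v \<le> b"
        using riesz_decomposition ab by blast
      then show "dual_apply f y \<le> P a + P b"
        using upper[of u a] upper[of v b] by (simp add: dual.add_right)
    qed (use ab in simp)
    have "P a \<le> P (a + b) - P b"
    proof (rule least)
      fix u assume u: "0 \<le> u" "u \<le> a"
      have "P b \<le> P (a + b) - dual_apply f u"
      proof (rule least)
        fix v assume v: "0 \<le> v" "v \<le> b"
        show "dual_apply f v \<le> P (a + b) - dual_apply f u"
          using upper[of "u + v" "a + b"] u v by (simp add: dual.add_right add_mono)
      qed (use ab in simp)
      then show "dual_apply f u \<le> P (a + b) - P b"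
        by simp
    qed (use ab in simp)
    then show "P a + P b \<le> P (a + b)"
      by simp
  qed
  have P_scale_le: "P (r *\<^sub>R a) \<le> r * P a" if "0 < r" "0 \<le> a" for r a
  proof (rule least)
    fix y assume y: "0 \<le> y" "y \<le> r *\<^sub>R a"
    have "inverse r *\<^sub>R y \<le> inverse r *\<^sub>R (r *\<^sub>R a)"
      using y that by (intro scaleR_left_mono) auto
    then have "dual_apply f (inverse r *\<^sub>R y) \<le> P a"
      using y that by (intro upper) (auto intro!: scaleR_nonneg_nonneg)
    then show "dual_apply f y \<le> r * P a"
      using that by (simp add: dual.scaleR_right field_simps)
  qed (use that in \<open>auto intro!: scaleR_nonneg_nonneg\<close>)
  have P_scale: "P (r *\<^sub>R a) = r * P a" if r: "0 < r" and a: "0 \<le> a" for r a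
  proof (rule antisym)
    have "P (inverse r *\<^sub>R (r *\<^sub>R a)) \<le> inverse r * P (r *\<^sub>R a)"
      using r a by (intro P_scale_le) (auto intro!: scaleR_nonneg_nonneg)
    then show "r * P a \<le> P (r *\<^sub>R a)"
      using r by (simp add: field_simps)
  qed (rule P_scale_le[OF that])
  define h where "h x = P (pprt x) - P (- nprt x)" for x
  have h_diff: "h (a - b) = P a - P b" if ab: "0 \<le> a" "0 \<le> b" for a b
  proof -
    have "pprt (a - b) + b = a + - nprt (a - b)"
      using prts[of "a - b"] by (simp add: algebra_simps)
    then have "P (pprt (a - b)) + P b = P a + P (- nprt (a - b))"
      using ab P_add[of "pprt (a - b)" b] P_add[of a "- nprt (a - b)"] by simp
    then show ?thesis
      by (simp add: h_def)
  qed
  have h_pos: "h x = P x" if "0 \<le> x" for x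
    using h_diff[of x 0] P_add[of 0 0] that by simp
  have h_add: "h (x + y) = h x + h y" for x y
  proof -
    have "x + y = (pprt x + pprt y) - (- nprt x + - nprt y)"
      using arg_cong2[OF prts prts, of "(+)" x y] by (simp add: algebra_simps)
    then have "h (x + y) = P (pprt x + pprt y) - P (- nprt x + - nprt y)"
      using h_diff[of "pprt x + pprt y" "- nprt x + - nprt y"] by (metis add_nonneg_nonneg
        neg_0_le_iff_le nprt_le_zero zero_le_pprt)
    then show ?thesis
      using P_add[of "pprt x" "pprt y"] P_add[of "- nprt x" "- nprt y"] by (simp add: h_def)
  qed
  have h_minus: "h (- x) = - h x" for x
    by (simp add: h_def pprt_neg nprt_neg)
  have h_scale_pos: "h (r *\<^sub>R x) = r * h x" if r: "0 < r" for r x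
  proof -
    have "r *\<^sub>R x = r *\<^sub>R pprt x - r *\<^sub>R (- nprt x)"
      by (metis diff_minus_eq_add prts scaleR_diff_right)
    then have "h (r *\<^sub>R x) = P (r *\<^sub>R pprt x) - P (r *\<^sub>R (- nprt x))"
      using h_diff[of "r *\<^sub>R pprt x" "r *\<^sub>R (- nprt x)"] r
      by (metis less_imp_le neg_0_le_iff_le nprt_le_zero scaleR_nonneg_nonneg zero_le_pprt)
    also have "\<dots> = r * P (pprt x) - r * P (- nprt x)"
      using r P_scale[of r "pprt x"] P_scale[of r "- nprt x"] by simp
    finally show ?thesis
      by (simp add: h_def algebra_simps)
  qed
  have h_scale: "h (r *\<^sub>R x) = r * h x" for r x
  proof (cases r "0::real" rule: linorder_cases)
    case less
    then have "h (- (r *\<^sub>R x)) = - r * h x"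
      using h_scale_pos[of "- r" x] by simp
    then show ?thesis
      by (simp add: h_minus)
  next
    case equal
    then show ?thesis
      using h_add[of 0 0] by simp
  qed (rule h_scale_pos)
  have P_bound: "\<bar>P z\<bar> \<le> norm x * norm f" if "0 \<le> z" "z \<le> \<bar>x\<bar>" for x z
  proof -
    have "P z \<le> norm f * norm z"
      using that by (intro least bd) auto
    also have "\<dots> \<le> norm f * norm x"
      using norm_mono_nonneg[of z "\<bar>x\<bar>"] that by (simp add: norm_abs mult_left_mono)
    finally show ?thesis
      using P_nonneg[of z] that by (simp add: mult.commute)
  qed
  have h_bound: "norm (h x) \<le> norm x * (2 * norm f)" for x
  proof -
    have "\<bar>P (pprt x)\<bar> \<le> norm x * norm f"
      by (rule P_bound) (auto simp: abs_prts)
    moreover have "\<bar>P (- nprt x)\<bar> \<le> norm x * norm f"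
      by (rule P_bound) (auto simp: abs_prts)
    ultimately show ?thesis
      by (simp add: h_def)
  qed
  have "bounded_linear h"
    using h_add h_scale h_bound by (intro bounded_linear_intro[where K = "2 * norm f"]) auto
  then obtain p where "dual_apply p = h"
    using ex_dual by blast
  then show ?thesis
    using upper least h_pos by (intro exI[of _ p]) auto
qed

instantiation dual :: (banach_lattice) "{ord, sup, inf, abs}"
begin

definition less_eq_dual :: "'a dual \<Rightarrow> 'a dual \<Rightarrow> bool"
  where "f \<le> g \<longleftrightarrow> (\<forall>x\<ge>0. dual_apply f x \<le> dual_apply g x)"

definition less_dual :: "'a dual \<Rightarrow> 'a dual \<Rightarrow> bool"
  where "f < g \<longleftrightarrow> f \<le> g \<and> \<not> g \<le> (f :: 'a dual)"

definition sup_dual :: "'a dual \<Rightarrow> 'a dual \<Rightarrow> 'a dual"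
  where "sup_dual f g = (THE h. f \<le> h \<and> g \<le> h \<and> (\<forall>k. f \<le> k \<and> g \<le> k \<longrightarrow> h \<le> k))"

definition inf_dual :: "'a dual \<Rightarrow> 'a dual \<Rightarrow> 'a dual"
  where "inf_dual f g = - sup (- f) (- g)"

definition abs_dual :: "'a dual \<Rightarrow> 'a dual"
  where "abs_dual f = sup f (- f)"

instance ..

end

instance dual :: (banach_lattice) order
proof
  fix f g h :: "'a dual"
  show "f < g \<longleftrightarrow> f \<le> g \<and> \<not> g \<le> f"
    by (rule less_dual_def)
  show "f \<le> f" "f \<le> g \<Longrightarrow> g \<le> h \<Longrightarrow> f \<le> h"
    by (auto simp: less_eq_dual_def intro: order_trans)
  show "f = g" if "f \<le> g" "g \<le> f"
  proof (rule dual_eqI)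
    fix x
    have eq: "dual_apply f z = dual_apply g z" if "0 \<le> z" for z
      using \<open>f \<le> g\<close> \<open>g \<le> f\<close> that by (auto simp: less_eq_dual_def intro: antisym)
    have "dual_apply f (- nprt x) = dual_apply g (- nprt x)"
      by (rule eq) simp
    then show "dual_apply f x = dual_apply g x"
      using eq[of "pprt x"] by (subst (1 2) prts[of x]) (simp add: dual.add_right dual.minus_right)
  qed
qed

lemma sup_dual_lub:
  fixes f g :: "'a::banach_lattice dual"
  shows "f \<le> sup f g" "g \<le> sup f g" "f \<le> k \<Longrightarrow> g \<le> k \<Longrightarrow> sup f g \<le> k"
    and sup_dual_least: "0 \<le> x \<Longrightarrow> (\<And>y. 0 \<le> y \<Longrightarrow> y \<le> x \<Longrightarrow>
      dual_apply f y + dual_apply g (x - y) \<le> c) \<Longrightarrow> dual_apply (sup f g) x \<le> c"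
proof -
  obtain p where P: "\<forall>x\<ge>0. (\<forall>y. 0 \<le> y \<and> y \<le> x \<longrightarrow> dual_apply (f - g) y \<le> dual_apply p x)
      \<and> (\<forall>c. (\<forall>y. 0 \<le> y \<and> y \<le> x \<longrightarrow> dual_apply (f - g) y \<le> c) \<longrightarrow> dual_apply p x \<le> c)"
    using ex_pos_part_dual[of "f - g"] by (rule exE)
  have p: "dual_apply (f - g) y \<le> dual_apply p x" if "0 \<le> y" "y \<le> x" for x y
    using P[rule_format, OF order_trans[OF that]] that by (simp only: simp_thms)
  have p_least: "dual_apply p x \<le> c"
    if "0 \<le> x" "\<And>y. 0 \<le> y \<Longrightarrow> y \<le> x \<Longrightarrow> dual_apply (f - g) y \<le> c" for x c
    using P[rule_format, OF that(1)] that(2) by blast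
  define s where "s = g + p"
  have fs: "f \<le> s"
    unfolding less_eq_dual_def
  proof (intro allI impI)
    fix x :: 'a assume "0 \<le> x"
    then show "dual_apply f x \<le> dual_apply s x"
      using p[of x x] by (simp add: s_def)
  qed
  have gs: "g \<le> s"
    unfolding less_eq_dual_def
  proof (intro allI impI)
    fix x :: 'a assume "0 \<le> x"
    then show "dual_apply g x \<le> dual_apply s x"
      using p[of 0 x] by (simp add: s_def dual.zero_right)
  qed
  have sk: "s \<le> k" if "f \<le> k" "g \<le> k" for k
    unfolding less_eq_dual_def
  proof (intro allI impI)
    fix x :: 'a assume x: "0 \<le> x"
    have "dual_apply p x \<le> dual_apply (k - g) x"
    proof (rule p_least[OF x])
      fix y assume y: "0 \<le> y" "y \<le> x"
      have "dual_apply f y \<le> dual_apply k y" "dual_apply g (x - y) \<le> dual_apply k (x - y)"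
        using that y by (auto simp: less_eq_dual_def)
      then show "dual_apply (f - g) y \<le> dual_apply (k - g) x"
        by (simp add: dual.diff_right)
    qed
    then show "dual_apply s x \<le> dual_apply k x"
      by (simp add: s_def)
  qed
  have sup_eq: "sup f g = s"
    unfolding sup_dual_def using fs gs sk by (intro the_equality) (auto intro: antisym)
  show "f \<le> sup f g" "g \<le> sup f g" "f \<le> k \<Longrightarrow> g \<le> k \<Longrightarrow> sup f g \<le> k"
    unfolding sup_eq using fs gs sk by auto
  show "dual_apply (sup f g) x \<le> c" if x: "0 \<le> x" and c: "\<And>y. 0 \<le> y \<Longrightarrow> y \<le> x \<Longrightarrow>
      dual_apply f y + dual_apply g (x - y) \<le> c"
  proof -
    have "dual_apply p x \<le> c - dual_apply g x"
    proof (rule p_least[OF x])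
      fix y assume "0 \<le> y" "y \<le> x"
      from c[OF this] show "dual_apply (f - g) y \<le> c - dual_apply g x"
        by (simp add: dual.diff_right)
    qed
    then show ?thesis
      by (simp add: sup_eq s_def)
  qed
qed

instance dual :: (banach_lattice) banach_lattice
proof
  fix f g h :: "'a dual" and a b :: real
  show "f \<le> sup f g" "g \<le> sup f g" "g \<le> f \<Longrightarrow> h \<le> f \<Longrightarrow> sup g h \<le> f"
    by (rule sup_dual_lub; assumption)+
  have neg: "- f \<le> - g \<longleftrightarrow> g \<le> f" for f g :: "'a dual"
    by (simp add: less_eq_dual_def)
  have neg1: "- f \<le> g \<longleftrightarrow> - g \<le> f" for f g :: "'a dual"
    using neg[of f "- g"] by simp
  have neg2: "f \<le> - g \<longleftrightarrow> g \<le> - f" for f g :: "'a dual"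
    using neg[of "- f" g] by simp
  show "inf f g \<le> f" "inf f g \<le> g"
    unfolding inf_dual_def by (subst neg1, rule sup_dual_lub)+
  show "f \<le> inf g h" if "f \<le> g" "f \<le> h"
    unfolding inf_dual_def by (subst neg2, rule sup_dual_lub) (simp_all add: neg that)
  show "f \<le> g \<Longrightarrow> h + f \<le> h + g"
    by (simp add: less_eq_dual_def)
  show "f \<le> g \<Longrightarrow> 0 \<le> a \<Longrightarrow> a *\<^sub>R f \<le> a *\<^sub>R g"
    by (simp add: less_eq_dual_def mult_left_mono)
  show "a \<le> b \<Longrightarrow> 0 \<le> f \<Longrightarrow> a *\<^sub>R f \<le> b *\<^sub>R f"
    by (simp add: less_eq_dual_def mult_right_mono)
  show "\<bar>f\<bar> = sup f (- f)"
    by (rule abs_dual_def)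
  show "norm f \<le> norm g" if le: "\<bar>f\<bar> \<le> \<bar>g\<bar>"
  proof (rule norm_dual_bound)
    fix x
    have f_le: "dual_apply f z \<le> dual_apply \<bar>f\<bar> z" "- dual_apply f z \<le> dual_apply \<bar>f\<bar> z"
      if "0 \<le> z" for z
      using that sup_dual_lub(1)[of f "- f"] sup_dual_lub(2)[of "- f" f]
      by (auto simp: abs_dual_def less_eq_dual_def)
    have "dual_apply f x = dual_apply f (pprt x) - dual_apply f (- nprt x)"
      by (subst prts[of x]) (simp add: dual.add_right dual.minus_right)
    moreover have "dual_apply \<bar>f\<bar> \<bar>x\<bar> = dual_apply \<bar>f\<bar> (pprt x) + dual_apply \<bar>f\<bar> (- nprt x)"
      by (simp add: abs_prts[of x] dual.diff_right dual.minus_right)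
    ultimately have "\<bar>dual_apply f x\<bar> \<le> dual_apply \<bar>f\<bar> \<bar>x\<bar>"
      using f_le[of "pprt x"] f_le[of "- nprt x"] by simp
    also have "\<dots> \<le> dual_apply \<bar>g\<bar> \<bar>x\<bar>"
      using le by (simp add: less_eq_dual_def)
    also have "\<dots> \<le> norm g * norm x"
      unfolding abs_dual_def
    proof (rule sup_dual_least)
      fix y assume y: "0 \<le> y" "y \<le> \<bar>x\<bar>"
      have "\<bar>y - (\<bar>x\<bar> - y)\<bar> \<le> \<bar>x\<bar>"
      proof (rule abs_leI)
        show "y - (\<bar>x\<bar> - y) \<le> \<bar>x\<bar>"
          using add_mono[OF y(2) y(2)] by (simp add: algebra_simps)
        show "- (y - (\<bar>x\<bar> - y)) \<le> \<bar>x\<bar>"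
          using add_nonneg_nonneg[OF y(1) y(1)] by (simp add: algebra_simps)
      qed
      then have "norm (y - (\<bar>x\<bar> - y)) \<le> norm x"
        using norm_mono_abs[of "y - (\<bar>x\<bar> - y)" x] by simp
      then have "norm g * norm (y - (\<bar>x\<bar> - y)) \<le> norm g * norm x"
        by (intro mult_left_mono) auto
      then show "dual_apply g y + dual_apply (- g) (\<bar>x\<bar> - y) \<le> norm g * norm x"
        using norm_dual_apply[of g "y - (\<bar>x\<bar> - y)"] by (simp add: dual.diff_right)
    qed simp
    finally show "\<bar>dual_apply f x\<bar> \<le> norm g * norm x" .
  qed simp
qed


section \<open>Limited sets and limitedly L- and M-weakly compact operators\<close>

definition weak_star_null :: "(nat \<Rightarrow> 'a::real_normed_vector dual) \<Rightarrow> bool" where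
  "weak_star_null f \<longleftrightarrow> (\<forall>x. (\<lambda>n. dual_apply (f n) x) \<longlonglongrightarrow> 0)"

definition weakly_null :: "(nat \<Rightarrow> 'a::real_normed_vector) \<Rightarrow> bool" where
  "weakly_null x \<longleftrightarrow> (\<forall>f. (\<lambda>n. dual_apply f (x n)) \<longlonglongrightarrow> 0)"

text \<open>The supremum is taken in \<^typ>\<open>ennreal\<close>, where the supremum over the empty set is \<open>0\<close>;
  in \<^typ>\<open>real\<close> that supremum would be unspecified.\<close>

definition limited_set :: "'a::banach set \<Rightarrow> bool" where
  "limited_set A \<longleftrightarrow> bounded A \<and>
    (\<forall>f. weak_star_null f \<longrightarrow>
      (\<lambda>n. SUP a\<in>A. ennreal \<bar>dual_apply (f n) a\<bar>) \<longlonglongrightarrow> 0)"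

definition dual_compose ::
    "'b::real_normed_vector dual \<Rightarrow> ('a::real_normed_vector \<Rightarrow>\<^sub>L 'b) \<Rightarrow> 'a dual" where
  "dual_compose f T = dual_of_blinfun (blinfun_of_dual f o\<^sub>L T)"

lemma dual_apply_compose [simp]: "dual_apply (dual_compose f T) x = dual_apply f (T x)"
  by (simp add: dual_compose_def dual_apply.rep_eq dual_of_blinfun_inverse)

lift_definition adjoint_op ::
    "('a::real_normed_vector \<Rightarrow>\<^sub>L 'b::real_normed_vector) \<Rightarrow> 'b dual \<Rightarrow>\<^sub>L 'a dual"
  is "\<lambda>T f. dual_compose f T"
proof (rule bounded_linear_intro)
  fix T :: "'a \<Rightarrow>\<^sub>L 'b" and f g :: "'b dual" and c :: real
  show "dual_compose (f + g) T = dual_compose f T + dual_compose g T"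
    "dual_compose (c *\<^sub>R f) T = c *\<^sub>R dual_compose f T"
    by (auto intro: dual_eqI)
  show "norm (dual_compose f T) \<le> norm f * norm T"
  proof (rule norm_dual_bound)
    fix x
    have "\<bar>dual_apply f (T x)\<bar> \<le> norm f * norm (T x)"
      by (rule norm_dual_apply)
    also have "\<dots> \<le> norm f * (norm T * norm x)"
      by (intro mult_left_mono norm_blinfun) simp
    finally show "\<bar>dual_apply (dual_compose f T) x\<bar> \<le> norm f * norm T * norm x"
      by (simp add: mult.assoc)
  qed simp
qed

lemma dual_apply_adjoint_op [simp]: "dual_apply (adjoint_op T f) x = dual_apply f (T x)"
  by (simp add: adjoint_op.rep_eq)

definition limitedly_Lwc :: "('a::banach \<Rightarrow>\<^sub>L 'b::banach_lattice) \<Rightarrow> bool" where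
  "limitedly_Lwc T \<longleftrightarrow> (\<forall>A. limited_set A \<longrightarrow> Lwc_set (T ` A))"

definition limitedly_Mwc :: "('a::banach_lattice \<Rightarrow>\<^sub>L 'b::banach) \<Rightarrow> bool" where
  "limitedly_Mwc T \<longleftrightarrow>
    (\<forall>x. disjoint_seq x \<and> bounded (range x) \<longrightarrow> weakly_null (\<lambda>n. T (x n)))"

end

theory Submission
  imports Defs
begin

text \<open>
  Part (i) and the implication from \<open>T'\<close> to \<open>T\<close> in (ii) rest on carrying disjointness over to the
  dual: for a disjoint sequence \<open>y\<close> in a Banach lattice and positive functionals \<open>g k\<close>, the components
  of the \<open>g k\<close> carried by the principal ideals of the \<open>y k\<close> are disjoint.  Hahn--Banach produces
  functionals dominated by these components that realise \<open>g k \<bar>y k\<bar>\<close>.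

  For the converse in (ii), let \<open>A\<close> be limited in \<open>Y'\<close>.  For disjoint bounded \<open>x k\<close> the sequence
  \<open>T (x k)\<close> is weakly null, hence weak-star null in \<open>Y''\<close>, so it converges to \<open>0\<close> uniformly on \<open>A\<close>.
  It remains to show, following Burkinshaw and Dodds, that a bounded set \<open>B\<close> of functionals on which
  disjoint bounded sequences converge uniformly to \<open>0\<close> is L-weakly compact.  A disjoint sequence
  \<open>f k\<close> of positive functionals dominated by \<open>B\<close> is first shown to be weak-star null, and then norm
  null; in both steps a failure yields positive vectors \<open>d k\<close> with \<open>f k (d k)\<close> large and
  \<open>f k (d i)\<close> small for \<open>i < k\<close>, and these can be made disjoint without losing much.
\<close>

section \<open>The Hahn--Banach theorem\<close>

definition sublinear :: "('a::real_vector \<Rightarrow> real) \<Rightarrow> bool" where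
  "sublinear p \<longleftrightarrow>
    (\<forall>x y. p (x + y) \<le> p x + p y) \<and> (\<forall>c x. 0 \<le> c \<longrightarrow> p (c *\<^sub>R x) = c * p x)"

lemma sublinear_add: "sublinear p \<Longrightarrow> p (x + y) \<le> p x + p y"
  and sublinear_scale: "sublinear p \<Longrightarrow> 0 \<le> c \<Longrightarrow> p (c *\<^sub>R x) = c * p x"
  by (auto simp: sublinear_def)

lemma sublinear_zero: "sublinear p \<Longrightarrow> p 0 = 0"
  using sublinear_scale[of p 0 0] by simp

lemma sublinear_minus: "sublinear p \<Longrightarrow> - p (- x) \<le> p x"
  using sublinear_add[of p x "- x"] sublinear_zero[of p] by simp

text \<open>One inequality in \<open>scale\<close> suffices: applied to \<open>inverse c\<close> and
  \<open>c *\<^sub>R x\<close> it gives the reverse one. At \<open>c = 0\<close>, subadditivity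
  yields \<open>0 \<le> p 0\<close>, so \<open>zero\<close> forces equality.\<close>

lemma sublinearI:
  assumes add: "\<And>x y. p (x + y) \<le> p x + p y"
    and scale: "\<And>c x. 0 < c \<Longrightarrow> p (c *\<^sub>R x) \<le> c * p x"
    and zero: "p 0 \<le> 0"
  shows "sublinear p"
  unfolding sublinear_def
proof (intro conjI allI impI)
  fix c :: real and x assume "0 \<le> c"
  then consider "c = 0" | "0 < c"
    by fastforce
  then show "p (c *\<^sub>R x) = c * p x"
  proof cases
    case 1
    then show ?thesis
      using add[of 0 0] zero by simp
  next
    case 2
    then have "p (inverse c *\<^sub>R (c *\<^sub>R x)) \<le> inverse c * p (c *\<^sub>R x)"
      by (intro scale) simp
    then have "c * p x \<le> p (c *\<^sub>R x)"
      using 2 by (simp add: field_simps)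
    then show ?thesis
      using scale[OF 2, of x] by simp
  qed
qed (rule add)

text \<open>This lowers \<open>p\<close> along the ray of \<open>z\<close>: in the infimum defining
  \<open>q\<close>, the choice \<open>t = 0\<close> gives \<open>q \<le> p\<close> and
  \<open>t = 1\<close> gives the bound at \<open>- z\<close>. For a minimal \<open>p\<close> it
  follows that \<open>q = p\<close>, which makes \<open>p\<close> odd at \<open>z\<close>.\<close>

lemma sublinear_directional:
  assumes p: "sublinear p"
  obtains q where "sublinear q" "\<And>x. q x \<le> p x" "q (- z) \<le> - p z"
proof -
  define q where "q y = (INF t\<in>{0..}. p (y + t *\<^sub>R z) - t * p z)" for y
  \<comment> \<open>Subadditivity for \<open>t *\<^sub>R z = (y + t *\<^sub>R z) + (- y)\<close>;
    the bound is independent of \<open>t\<close>, so the infimum is finite.\<close>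
  have lower: "- p (- y) \<le> p (y + t *\<^sub>R z) - t * p z" if "0 \<le> t" for y t
    using sublinear_add[OF p, of "y + t *\<^sub>R z" "- y"] sublinear_scale[OF p that, of z] by simp
  have q_le: "q y \<le> p (y + t *\<^sub>R z) - t * p z" if "0 \<le> t" for y t
    unfolding q_def using that lower
    by (intro cINF_lower) (auto intro!: bdd_belowI[where m = "- p (- y)"])
  have le_q: "c \<le> q y" if "\<And>t. 0 \<le> t \<Longrightarrow> c \<le> p (y + t *\<^sub>R z) - t * p z" for y c
    unfolding q_def using that by (intro cINF_greatest) auto
  have "sublinear q"
  proof (rule sublinearI)
    fix x y
    have "q (x + y) - q y \<le> q x"
    proof (rule le_q)
      fix s :: real assume s: "0 \<le> s"
      have "q (x + y) - (p (x + s *\<^sub>R z) - s * p z) \<le> q y"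
      proof (rule le_q)
        fix t :: real assume t: "0 \<le> t"
        have "p ((x + y) + (s + t) *\<^sub>R z) \<le> p (x + s *\<^sub>R z) + p (y + t *\<^sub>R z)"
          using sublinear_add[OF p, of "x + s *\<^sub>R z" "y + t *\<^sub>R z"]
          by (simp add: algebra_simps)
        then show "q (x + y) - (p (x + s *\<^sub>R z) - s * p z) \<le> p (y + t *\<^sub>R z) - t * p z"
          using q_le[of "s + t" "x + y"] s t by (simp add: algebra_simps)
      qed
      then show "q (x + y) - q y \<le> p (x + s *\<^sub>R z) - s * p z"
        by simp
    qed
    then show "q (x + y) \<le> q x + q y"
      by simp
  next
    fix c :: real and x assume c: "0 < c"
    have "q (c *\<^sub>R x) / c \<le> q x"
    proof (rule le_q)
      fix t :: real assume t: "0 \<le> t"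
      have "q (c *\<^sub>R x) \<le> p (c *\<^sub>R x + (c * t) *\<^sub>R z) - c * t * p z"
        using c t by (intro q_le) simp
      also have "\<dots> = c * (p (x + t *\<^sub>R z) - t * p z)"
        using sublinear_scale[OF p, of c "x + t *\<^sub>R z"] c by (simp add: algebra_simps)
      finally show "q (c *\<^sub>R x) / c \<le> p (x + t *\<^sub>R z) - t * p z"
        using c by (simp add: field_simps)
    qed
    then show "q (c *\<^sub>R x) \<le> c * q x"
      using c by (simp add: field_simps)
  next
    show "q 0 \<le> 0"
      using q_le[of 0 0] sublinear_zero[OF p] by simp
  qed
  moreover have "q x \<le> p x" for x
    using q_le[of 0 x] by simp
  moreover have "q (- z) \<le> - p z"
    using q_le[of 1 "- z"] sublinear_zero[OF p] by simp
  ultimately show thesis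
    by (rule that)
qed

text \<open>Zorn's lemma for the reversed pointwise order on the sublinear functionals below
  \<open>p\<close>; a nonempty chain is bounded by its pointwise infimum.\<close>

lemma ex_minimal_sublinear:
  assumes p: "sublinear p"
  obtains m where "sublinear m" "m \<le> p" "\<And>q. sublinear q \<Longrightarrow> q \<le> m \<Longrightarrow> q = m"
proof -
  define A where "A = {q. sublinear q \<and> q \<le> p}"
  have "\<exists>m\<in>A. \<forall>q\<in>A. q \<le> m \<longrightarrow> q = m"
  proof (rule predicate_Zorn)
    show "partial_order_on A (relation_of (\<lambda>q r. r \<le> q) A)"
      by (intro partial_order_on_relation_ofI) auto
    fix C assume C: "C \<in> Chains (relation_of (\<lambda>q r. r \<le> q) A)"
    then have CA: "q \<in> A" if "q \<in> C" for q
      using that by (auto simp: Chains_def relation_of_def)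
    have chain: "q \<le> r \<or> r \<le> q" if "q \<in> C" "r \<in> C" for q r
      using C that by (auto simp: Chains_def relation_of_def)
    show "\<exists>u\<in>A. \<forall>q\<in>C. u \<le> q"
    proof (cases "C = {}")
      case True
      then show ?thesis
        using p by (auto simp: A_def)
    next
      case False
      define u where "u x = (INF q\<in>C. q x)" for x
      \<comment> \<open>From \<open>- p (- x) \<le> - q (- x) \<le> q x\<close>; the bound is the
        same for all \<open>q\<close>.\<close>
      have lower: "- p (- x) \<le> q x" if "q \<in> C" for q x
        using CA[OF that] sublinear_minus[of q x] by (auto simp: A_def le_fun_def)
          (meson le_imp_neg_le order_trans)
      have u_le: "u x \<le> q x" if "q \<in> C" for q x
        unfolding u_def using that lower
        by (intro cINF_lower) (auto intro!: bdd_belowI[where m = "- p (- x)"])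
      have le_u: "c \<le> u x" if "\<And>q. q \<in> C \<Longrightarrow> c \<le> q x" for c x
        unfolding u_def using that False by (intro cINF_greatest) auto
      have "sublinear u"
      proof (rule sublinearI)
        fix x y
        have "u (x + y) - u y \<le> u x"
        proof (rule le_u)
          fix q assume q: "q \<in> C"
          have "u (x + y) - q x \<le> u y"
          proof (rule le_u)
            fix r assume r: "r \<in> C"
            \<comment> \<open>The chain property enters here: a single member \<open>s\<close> lies
              below both \<open>q\<close> and \<open>r\<close>.\<close>
            obtain s where s: "s \<in> C" "s \<le> q" "s \<le> r"
              using chain[OF q r] q r by auto
            have "u (x + y) \<le> s (x + y)"
              by (rule u_le[OF s(1)])
            also have "\<dots> \<le> s x + s y"
              using CA[OF s(1)] by (auto simp: A_def intro: sublinear_add)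
            also have "\<dots> \<le> q x + r y"
              using s by (intro add_mono) (auto simp: le_fun_def)
            finally show "u (x + y) - q x \<le> r y"
              by simp
          qed
          then show "u (x + y) - u y \<le> q x"
            by simp
        qed
        then show "u (x + y) \<le> u x + u y"
          by simp
      next
        fix c :: real and x assume c: "0 < c"
        have "u (c *\<^sub>R x) / c \<le> u x"
        proof (rule le_u)
          fix q assume q: "q \<in> C"
          then have "q (c *\<^sub>R x) = c * q x"
            using CA[OF q] c by (auto simp: A_def intro: sublinear_scale)
          then show "u (c *\<^sub>R x) / c \<le> q x"
            using u_le[OF q, of "c *\<^sub>R x"] c by (simp add: field_simps)
        qed
        then show "u (c *\<^sub>R x) \<le> c * u x"
          using c by (simp add: field_simps)
      next
        obtain q where "q \<in> C"
          using False by blast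
        then show "u 0 \<le> 0"
          using u_le[of q 0] CA[of q] by (auto simp: A_def sublinear_zero)
      qed
      moreover have "u \<le> p"
        using False CA u_le by (fastforce simp: A_def le_fun_def intro: order_trans)
      ultimately show ?thesis
        using u_le by (auto simp: A_def le_fun_def)
    qed
  qed
  then obtain m where "m \<in> A" and min: "\<And>q. q \<in> A \<Longrightarrow> q \<le> m \<Longrightarrow> q = m"
    by blast
  then show thesis
    by (intro that[of m]) (auto simp: A_def intro: order_trans)
qed

text \<open>A minimal sublinear functional is odd, because lowering it along any direction cannot
  change it, and oddness turns subadditivity into additivity. Lowering \<open>p\<close> along
  \<open>z\<close> beforehand forces the value at \<open>z\<close>.\<close>

theorem hahn_banach_sublinear:
  fixes p :: "'a::real_vector \<Rightarrow> real"
  assumes p: "sublinear p"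
  obtains f where "linear f" "\<And>x. f x \<le> p x" "f z = p z"
proof -
  obtain q where q: "sublinear q" "\<And>x. q x \<le> p x" "q (- z) \<le> - p z"
    using sublinear_directional[OF p] by metis
  obtain m where m: "sublinear m" "m \<le> q"
    and min: "\<And>r. sublinear r \<Longrightarrow> r \<le> m \<Longrightarrow> r = m"
    using ex_minimal_sublinear[OF q(1)] by metis
  have odd: "m (- x) = - m x" for x
  proof -
    obtain r where r: "sublinear r" "\<And>y. r y \<le> m y" "r (- x) \<le> - m x"
      using sublinear_directional[OF m(1)] by metis
    then have "r = m"
      by (intro min) (auto simp: le_fun_def)
    then show ?thesis
      using r(3) sublinear_minus[OF m(1), of x] by simp
  qed
  have "linear m"
  proof (rule linearI)
    show "m (x + y) = m x + m y" for x y
      using sublinear_add[OF m(1), of x y] sublinear_add[OF m(1), of "- x" "- y"]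
        odd[of x] odd[of y] odd[of "x + y"] by simp
    show "m (c *\<^sub>R x) = c *\<^sub>R m x" for c x
    proof (cases "0 \<le> c")
      case False
      then have "m (- (c *\<^sub>R x)) = - c * m x"
        using sublinear_scale[OF m(1), of "- c" x] by simp
      then show ?thesis
        by (simp add: odd)
    qed (simp add: sublinear_scale[OF m(1)])
  qed
  moreover have "m x \<le> p x" for x
    using m(2) q(2) by (meson le_funD order_trans)
  moreover have "m z = p z"
    using m(2) q(3) odd[of z] \<open>m z \<le> p z\<close> by (force simp: le_fun_def dest: spec[of _ "- z"])
  ultimately show thesis
    by (rule that)
qed

text \<open>Domination at both \<open>x\<close> and \<open>- x\<close> bounds the modulus of the
  Hahn-Banach functional by \<open>C * norm x\<close>, so it is continuous.\<close>

lemma ex_dual_dominated: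
  fixes p :: "'a::real_normed_vector \<Rightarrow> real"
  assumes p: "sublinear p" and bound: "\<And>x. p x \<le> C * norm x"
  obtains f where "\<And>x. dual_apply f x \<le> p x" "dual_apply f z = p z"
proof -
  obtain h where h: "linear h" "\<And>x. h x \<le> p x" "h z = p z"
    using hahn_banach_sublinear[OF p] by metis
  have "norm (h x) \<le> norm x * C" for x
    using h(2)[of x] h(2)[of "- x"] bound[of x] bound[of "- x"] linear_neg[OF h(1), of x]
    by (simp add: mult.commute)
  then have "bounded_linear h"
    using h(1) by (intro bounded_linear_intro[where K = C]) (auto simp: linear_add linear_scale)
  then show thesis
    using ex_dual h that by metis
qed


section \<open>Disjointness in a Banach lattice and in its dual\<close>

lemma scaleR_inf_distrib:
  fixes a b :: "'a::banach_lattice"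
  assumes c: "0 < c"
  shows "c *\<^sub>R inf a b = inf (c *\<^sub>R a) (c *\<^sub>R b)"
proof (rule antisym)
  show "c *\<^sub>R inf a b \<le> inf (c *\<^sub>R a) (c *\<^sub>R b)"
    using c by (intro inf_greatest scaleR_left_mono) auto
  have "inverse c *\<^sub>R inf (c *\<^sub>R a) (c *\<^sub>R b) \<le> inverse c *\<^sub>R (c *\<^sub>R a)"
    "inverse c *\<^sub>R inf (c *\<^sub>R a) (c *\<^sub>R b) \<le> inverse c *\<^sub>R (c *\<^sub>R b)"
    using c by (intro scaleR_left_mono inf_le1 inf_le2; simp)+
  then have "inverse c *\<^sub>R inf (c *\<^sub>R a) (c *\<^sub>R b) \<le> inf a b"
    using c by simp
  then have "c *\<^sub>R (inverse c *\<^sub>R inf (c *\<^sub>R a) (c *\<^sub>R b)) \<le> c *\<^sub>R inf a b"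
    using c by (intro scaleR_left_mono) auto
  then show "inf (c *\<^sub>R a) (c *\<^sub>R b) \<le> c *\<^sub>R inf a b"
    using c by simp
qed

lemma abs_scaleR_le:
  fixes x :: "'a::banach_lattice"
  assumes "0 \<le> c"
  shows "\<bar>c *\<^sub>R x\<bar> \<le> c *\<^sub>R \<bar>x\<bar>"
proof (rule abs_leI)
  show "c *\<^sub>R x \<le> c *\<^sub>R \<bar>x\<bar>"
    using assms by (intro scaleR_left_mono abs_ge_self)
  have "c *\<^sub>R (- x) \<le> c *\<^sub>R \<bar>x\<bar>"
    using assms by (intro scaleR_left_mono abs_ge_minus_self)
  then show "- (c *\<^sub>R x) \<le> c *\<^sub>R \<bar>x\<bar>"
    by simp
qed

text \<open>The right-hand side expands into the infimum of \<open>a + b\<close>,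
  \<open>c + b\<close>, \<open>a + c\<close> and \<open>c + c\<close>, each of which is above the
  left-hand side.\<close>

lemma inf_add_le:
  fixes a b c :: "'a::banach_lattice"
  assumes "0 \<le> a" "0 \<le> b" "0 \<le> c"
  shows "inf (a + b) c \<le> inf a c + inf b c"
proof -
  have "inf a c + inf b c = inf (inf (a + b) (c + b)) (inf (a + c) (c + c))"
    by (simp only: add_inf_distrib_left add_inf_distrib_right)
  moreover have "inf (a + b) c \<le> inf (inf (a + b) (c + b)) (inf (a + c) (c + c))"
    using assms by (intro inf_greatest)
      (auto intro: le_infI1 le_infI2 simp only: le_add_same_cancel1 le_add_same_cancel2)
  ultimately show ?thesis
    by simp
qed

lemma disjoint_mono:
  fixes a b c d :: "'a::banach_lattice"
  assumes "inf b d = 0" "0 \<le> a" "a \<le> b" "0 \<le> c" "c \<le> d"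
  shows "inf a c = 0"
  using assms by (intro antisym) (metis inf_mono, simp)

lemma disjoint_scaleR:
  fixes a b :: "'a::banach_lattice"
  assumes "inf a b = 0" "0 \<le> c" "0 \<le> d"
  shows "inf (c *\<^sub>R a) (d *\<^sub>R b) = 0"
proof (rule disjoint_mono)
  have ab: "0 \<le> a" "0 \<le> b"
    using assms(1) by (metis inf_le1, metis inf_le2)
  \<comment> \<open>Both multiples are compared with one common factor; the summand 1 keeps it
    positive when \<open>c\<close> and \<open>d\<close> vanish.\<close>
  show "inf ((c + d + 1) *\<^sub>R a) ((c + d + 1) *\<^sub>R b) = 0"
    using scaleR_inf_distrib[of "c + d + 1" a b] assms by simp
  show "0 \<le> c *\<^sub>R a" "0 \<le> d *\<^sub>R b"
    using assms ab by (auto intro: scaleR_nonneg_nonneg)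
  show "c *\<^sub>R a \<le> (c + d + 1) *\<^sub>R a" "d *\<^sub>R b \<le> (c + d + 1) *\<^sub>R b"
    using assms ab by (auto intro: scaleR_right_mono)
qed

lemma disjoint_sum:
  fixes a :: "'a::banach_lattice"
  assumes "finite J" "0 \<le> a" "\<And>j. j \<in> J \<Longrightarrow> 0 \<le> g j \<and> inf a (g j) = 0"
  shows "inf a (sum g J) = 0"
  using assms
proof (induction J rule: finite_induct)
  case (insert j J)
  have "inf (g j + sum g J) a \<le> inf (g j) a + inf (sum g J) a"
    using insert by (intro inf_add_le) (auto intro: sum_nonneg)
  also have "\<dots> = 0"
    using insert by (simp add: inf_commute)
  finally show ?case
    using insert by (intro antisym) (auto simp: inf_commute intro!: add_nonneg_nonneg sum_nonneg)
qed (simp add: inf_absorb2)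

text \<open>Adding \<open>nprt a\<close> turns the two parts into \<open>a\<close> and
  \<open>0\<close>, whose infimum is again \<open>nprt a\<close>.\<close>

lemma inf_pprt_uminus:
  fixes a :: "'a::banach_lattice"
  shows "inf (pprt a) (pprt (- a)) = 0"
proof -
  have "nprt a + inf (pprt a) (pprt (- a)) = inf a 0"
    by (simp add: add_inf_distrib_left pprt_neg) (metis add.commute prts)
  then show ?thesis
    by (simp add: nprt_def)
qed

lemma le_pprt:
  fixes a :: "'a::banach_lattice"
  shows "a \<le> pprt a"
  by (simp add: pprt_def)

lemma pprt_diff_le:
  fixes a b :: "'a::banach_lattice"
  assumes "0 \<le> a" "0 \<le> b"
  shows "pprt (a - b) \<le> a"
  using assms by (simp add: pprt_def)

section \<open>Lattice operations of functionals, evaluated at positive vectors\<close>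

lemma dual_apply_mono_fun: "f \<le> g \<Longrightarrow> 0 \<le> x \<Longrightarrow> dual_apply f x \<le> dual_apply g x"
  by (simp add: less_eq_dual_def)

lemma dual_apply_nonneg: "0 \<le> f \<Longrightarrow> 0 \<le> x \<Longrightarrow> 0 \<le> dual_apply f x"
  by (simp add: less_eq_dual_def)

lemma dual_apply_mono:
  assumes "0 \<le> f" "x \<le> y"
  shows "dual_apply f x \<le> dual_apply f y"
  using dual_apply_nonneg[of f "y - x"] assms by (simp add: dual.diff_right)

lemma abs_dual_apply: "\<bar>dual_apply f x\<bar> \<le> dual_apply \<bar>f\<bar> \<bar>x\<bar>"
proof -
  have *: "dual_apply f z \<le> dual_apply \<bar>f\<bar> z" "- dual_apply f z \<le> dual_apply \<bar>f\<bar> z" if "0 \<le> z" for z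
    using dual_apply_mono_fun[OF abs_ge_self that, of f]
      dual_apply_mono_fun[OF abs_ge_minus_self that, of f] by simp_all
  have "dual_apply f x = dual_apply f (pprt x) - dual_apply f (- nprt x)"
    by (subst prts[of x]) (simp add: dual.add_right dual.minus_right)
  moreover have "dual_apply \<bar>f\<bar> \<bar>x\<bar> = dual_apply \<bar>f\<bar> (pprt x) + dual_apply \<bar>f\<bar> (- nprt x)"
    by (simp add: abs_prts[of x] dual.diff_right dual.minus_right)
  ultimately show ?thesis
    using *[of "pprt x"] *[of "- nprt x"] by simp
qed

text \<open>One half of the Riesz-Kantorovich formula for the modulus:
  \<open>f y + (- f) (x - y)\<close> is the value of \<open>f\<close> at \<open>y - (x - y)\<close>,
  a vector of modulus at most \<open>x\<close>.\<close>

lemma abs_dual_least: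
  assumes x: "0 \<le> x" and c: "\<And>w. \<bar>w\<bar> \<le> x \<Longrightarrow> dual_apply f w \<le> c"
  shows "dual_apply \<bar>f\<bar> x \<le> c"
  unfolding abs_dual_def
proof (rule sup_dual_least[OF x])
  fix y assume y: "0 \<le> y" "y \<le> x"
  have "\<bar>y - (x - y)\<bar> \<le> x"
  proof (rule abs_leI)
    show "y - (x - y) \<le> x"
      using add_mono[OF y(2) y(2)] by (simp add: algebra_simps)
    show "- (y - (x - y)) \<le> x"
      using add_nonneg_nonneg[OF y(1) y(1)] by (simp add: algebra_simps)
  qed
  from c[OF this] show "dual_apply f y + dual_apply (- f) (x - y) \<le> c"
    by (simp add: dual.diff_right)
qed

lemma inf_dual_greatest:
  assumes x: "0 \<le> x"
    and c: "\<And>y. 0 \<le> y \<Longrightarrow> y \<le> x \<Longrightarrow> c \<le> dual_apply f y + dual_apply g (x - y)"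
  shows "c \<le> dual_apply (inf f g) x"
proof -
  have "dual_apply (sup (- f) (- g)) x \<le> - c"
    using c by (intro sup_dual_least[OF x]) fastforce
  then show ?thesis
    unfolding inf_dual_def dual_apply_simps by simp
qed

text \<open>The Riesz-Kantorovich formula for the infimum: the sums \<open>f (x - y) + g y\<close>
  come arbitrarily close to 0. Thus \<open>f\<close> has almost all of its value on
  \<open>y\<close>, and \<open>g\<close> on \<open>x - y\<close>.\<close>

lemma disjoint_dual_split:
  assumes "inf f g = 0" "0 \<le> x" "0 < \<delta>"
  obtains y where "0 \<le> y" "y \<le> x" "dual_apply f (x - y) + dual_apply g y < \<delta>"
proof -
  have "\<exists>y. 0 \<le> y \<and> y \<le> x \<and> dual_apply g y + dual_apply f (x - y) < \<delta>"
  proof (rule ccontr)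
    assume "\<not> ?thesis"
    then have "\<delta> \<le> dual_apply (inf g f) x"
      by (intro inf_dual_greatest[OF assms(2)]) (metis not_le)
    then show False
      using assms by (simp add: inf_commute[of g f])
  qed
  then show thesis
    using that by (metis add.commute)
qed


section \<open>Functionals carried by an element\<close>

text \<open>The gauge of the component of \<open>g\<close> carried by the principal ideal of \<open>y\<close>.  It is additive on
  the positive cone, but sublinearity suffices to extract functionals from it by
  Hahn--Banach.\<close>

definition ideal_part :: "'a::banach_lattice dual \<Rightarrow> 'a \<Rightarrow> 'a \<Rightarrow> real" where
  "ideal_part g y x = (SUP r\<in>{0..}. dual_apply g (inf \<bar>x\<bar> (r *\<^sub>R y)))"

context
  fixes g :: "'a::banach_lattice dual" and y :: 'a
  assumes g: "0 \<le> g" and y: "0 \<le> y"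
begin

lemma ideal_part_upper: "0 \<le> r \<Longrightarrow> dual_apply g (inf \<bar>x\<bar> (r *\<^sub>R y)) \<le> ideal_part g y x"
  unfolding ideal_part_def using g
  by (intro cSUP_upper) (auto intro!: bdd_aboveI[where M = "dual_apply g \<bar>x\<bar>"] dual_apply_mono)

lemma ideal_part_least:
  "(\<And>r. 0 \<le> r \<Longrightarrow> dual_apply g (inf \<bar>x\<bar> (r *\<^sub>R y)) \<le> c) \<Longrightarrow> ideal_part g y x \<le> c"
  unfolding ideal_part_def by (intro cSUP_least) auto

lemma ideal_part_le: "ideal_part g y x \<le> dual_apply g \<bar>x\<bar>"
  using g by (intro ideal_part_least dual_apply_mono) auto

lemma ideal_part_mono:
  assumes "\<bar>x\<bar> \<le> \<bar>z\<bar>"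
  shows "ideal_part g y x \<le> ideal_part g y z"
proof (rule ideal_part_least)
  fix r :: real assume r: "0 \<le> r"
  have "dual_apply g (inf \<bar>x\<bar> (r *\<^sub>R y)) \<le> dual_apply g (inf \<bar>z\<bar> (r *\<^sub>R y))"
    using g assms by (intro dual_apply_mono inf_mono) auto
  also have "\<dots> \<le> ideal_part g y z"
    by (rule ideal_part_upper[OF r])
  finally show "dual_apply g (inf \<bar>x\<bar> (r *\<^sub>R y)) \<le> ideal_part g y z" .
qed

text \<open>Subadditivity comes from \<open>inf_add_le\<close>, homogeneity from rescaling
  \<open>r\<close> to \<open>r / c\<close>.\<close>

lemma sublinear_ideal_part: "sublinear (ideal_part g y)"
proof (rule sublinearI)
  fix u v
  show "ideal_part g y (u + v) \<le> ideal_part g y u + ideal_part g y v"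
  proof (rule ideal_part_least)
    fix r :: real assume r: "0 \<le> r"
    have "inf \<bar>u + v\<bar> (r *\<^sub>R y) \<le> inf (\<bar>u\<bar> + \<bar>v\<bar>) (r *\<^sub>R y)"
      by (intro inf_mono abs_triangle_ineq) auto
    also have "\<dots> \<le> inf \<bar>u\<bar> (r *\<^sub>R y) + inf \<bar>v\<bar> (r *\<^sub>R y)"
      using r y by (intro inf_add_le) (auto intro: scaleR_nonneg_nonneg)
    finally have "dual_apply g (inf \<bar>u + v\<bar> (r *\<^sub>R y))
        \<le> dual_apply g (inf \<bar>u\<bar> (r *\<^sub>R y) + inf \<bar>v\<bar> (r *\<^sub>R y))"
      by (rule dual_apply_mono[OF g])
    then show "dual_apply g (inf \<bar>u + v\<bar> (r *\<^sub>R y)) \<le> ideal_part g y u + ideal_part g y v"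
      using ideal_part_upper[OF r, of u] ideal_part_upper[OF r, of v] by (simp add: dual.add_right)
  qed
next
  fix c :: real and u assume c: "0 < c"
  show "ideal_part g y (c *\<^sub>R u) \<le> c * ideal_part g y u"
  proof (rule ideal_part_least)
    fix r :: real assume r: "0 \<le> r"
    have "inf \<bar>c *\<^sub>R u\<bar> (r *\<^sub>R y) \<le> inf (c *\<^sub>R \<bar>u\<bar>) (c *\<^sub>R ((r / c) *\<^sub>R y))"
      using c by (intro inf_mono abs_scaleR_le) auto
    also have "\<dots> = c *\<^sub>R inf \<bar>u\<bar> ((r / c) *\<^sub>R y)"
      by (rule scaleR_inf_distrib[OF c, symmetric])
    finally have "dual_apply g (inf \<bar>c *\<^sub>R u\<bar> (r *\<^sub>R y)) \<le> c * dual_apply g (inf \<bar>u\<bar> ((r / c) *\<^sub>R y))"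
      using dual_apply_mono[OF g] by (metis dual.scaleR_right real_scaleR_def)
    also have "\<dots> \<le> c * ideal_part g y u"
      using c r by (intro mult_left_mono ideal_part_upper) auto
    finally show "dual_apply g (inf \<bar>c *\<^sub>R u\<bar> (r *\<^sub>R y)) \<le> c * ideal_part g y u" .
  qed
next
  show "ideal_part g y 0 \<le> 0"
    using ideal_part_le[of 0] by (simp add: dual.zero_right)
qed

text \<open>A truncation of \<open>x\<close> that nearly attains the supremum in
  \<open>ideal_part\<close> leaves a remainder with hardly any component in the ideal of
  \<open>y\<close>.\<close>

lemma ideal_part_tail:
  assumes "0 \<le> x" "0 < \<delta>"
  obtains r where "0 \<le> r" "ideal_part g y (x - inf x (r *\<^sub>R y)) \<le> \<delta>"
proof -
  obtain r where r: "0 \<le> r" and close: "ideal_part g y x - \<delta> < dual_apply g (inf x (r *\<^sub>R y))"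
    using ideal_part_least[of x "ideal_part g y x - \<delta>"] assms by (force simp: not_le)
  define u where "u = inf x (r *\<^sub>R y)"
  have "ideal_part g y (x - u) \<le> ideal_part g y x - dual_apply g u"
  proof (rule ideal_part_least)
    fix s :: real assume s: "0 \<le> s"
    \<comment> \<open>A truncation of the remainder, added to \<open>u\<close>, stays below a
      truncation of \<open>x\<close> at a larger multiple, so its value under \<open>g\<close> is at
      most the gap to the supremum.\<close>
    have "inf (x - u) (s *\<^sub>R y) + u \<le> inf x ((s + r) *\<^sub>R y)"
    proof (rule inf_greatest)
      have "inf (x - u) (s *\<^sub>R y) + u \<le> (x - u) + u"
        by (intro add_right_mono inf_le1)
      then show "inf (x - u) (s *\<^sub>R y) + u \<le> x"
        by simp
      have "inf (x - u) (s *\<^sub>R y) + u \<le> s *\<^sub>R y + r *\<^sub>R y"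
        unfolding u_def by (intro add_mono inf_le2)
      then show "inf (x - u) (s *\<^sub>R y) + u \<le> (s + r) *\<^sub>R y"
        by (simp add: scaleR_left_distrib)
    qed
    then have "dual_apply g (inf (x - u) (s *\<^sub>R y) + u) \<le> dual_apply g (inf x ((s + r) *\<^sub>R y))"
      by (rule dual_apply_mono[OF g])
    also have "\<dots> \<le> ideal_part g y x"
      using ideal_part_upper[of "s + r" x] r s assms by simp
    finally have "dual_apply g (inf (x - u) (s *\<^sub>R y)) \<le> ideal_part g y x - dual_apply g u"
      by (simp add: dual.add_right)
    moreover have "\<bar>x - u\<bar> = x - u"
      by (simp only: abs_of_nonneg diff_ge_0_iff_ge u_def inf_le1)
    ultimately show "dual_apply g (inf \<bar>x - u\<bar> (s *\<^sub>R y)) \<le> ideal_part g y x - dual_apply g u"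
      by simp
  qed
  then show thesis
    using that[OF r] close by (simp add: u_def)
qed

text \<open>Hahn-Banach for the gauge, exact at \<open>z\<close>. The gauge is monotone in the
  modulus of its argument, so it also dominates \<open>\<bar>h\<bar>\<close>; the multiple
  \<open>r = 1\<close> gives the lower bound at \<open>z\<close>.\<close>

lemma ex_dual_ideal_part:
  obtains h where "\<bar>h\<bar> \<le> g" "\<And>x. 0 \<le> x \<Longrightarrow> dual_apply \<bar>h\<bar> x \<le> ideal_part g y x"
    "dual_apply g (inf \<bar>z\<bar> y) \<le> dual_apply h z"
proof -
  have "ideal_part g y x \<le> norm g * norm x" for x
    using ideal_part_le[of x] norm_dual_apply[of g "\<bar>x\<bar>"] by (simp add: norm_abs)
  then obtain h where h: "\<And>x. dual_apply h x \<le> ideal_part g y x"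
    and hz: "dual_apply h z = ideal_part g y z"
    using ex_dual_dominated[OF sublinear_ideal_part] by metis
  have part: "dual_apply \<bar>h\<bar> x \<le> ideal_part g y x" if "0 \<le> x" for x
  proof (rule abs_dual_least[OF that])
    fix w assume "\<bar>w\<bar> \<le> x"
    then show "dual_apply h w \<le> ideal_part g y x"
      using h[of w] ideal_part_mono[of w x] that by simp
  qed
  moreover have "\<bar>h\<bar> \<le> g"
    unfolding less_eq_dual_def
  proof (intro allI impI)
    fix x :: 'a assume "0 \<le> x"
    then show "dual_apply \<bar>h\<bar> x \<le> dual_apply g x"
      using part[of x] ideal_part_le[of x] by simp
  qed
  moreover have "dual_apply g (inf \<bar>z\<bar> y) \<le> dual_apply h z"
    using ideal_part_upper[of 1 z] hz by simp
  ultimately show thesis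
    by (intro that)
qed

end

text \<open>Split \<open>x\<close> into a part \<open>u\<close> below a multiple of \<open>y\<close>
  and a remainder. On \<open>u\<close> the functional \<open>\<bar>h'\<bar>\<close> is zero, since
  \<open>u\<close> is disjoint from all multiples of \<open>y'\<close>; on the remainder
  \<open>\<bar>h\<bar>\<close> is small.\<close>

lemma disjoint_ideal_parts:
  assumes g: "0 \<le> g" "0 \<le> g'" and yy': "inf y y' = 0"
    and h: "\<And>x. 0 \<le> x \<Longrightarrow> dual_apply \<bar>h\<bar> x \<le> ideal_part g y x"
    and h': "\<And>x. 0 \<le> x \<Longrightarrow> dual_apply \<bar>h'\<bar> x \<le> ideal_part g' y' x"
  shows "inf \<bar>h\<bar> \<bar>h'\<bar> = 0"
proof (rule antisym)
  have y: "0 \<le> y" "0 \<le> y'"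
    using yy' by (metis inf_le1, metis inf_le2)
  show "inf \<bar>h\<bar> \<bar>h'\<bar> \<le> 0"
    unfolding less_eq_dual_def
  proof (intro allI impI)
    fix x :: 'a assume x: "0 \<le> x"
    show "dual_apply (inf \<bar>h\<bar> \<bar>h'\<bar>) x \<le> dual_apply 0 x"
    proof (rule field_le_epsilon)
      fix \<delta> :: real assume "0 < \<delta>"
      then obtain r where r: "0 \<le> r" "ideal_part g y (x - inf x (r *\<^sub>R y)) \<le> \<delta>"
        using ideal_part_tail[OF g(1) y(1) x] by metis
      define u where "u = inf x (r *\<^sub>R y)"
      have u: "0 \<le> u" "u \<le> x" "u \<le> r *\<^sub>R y"
        using x y r by (auto simp: u_def intro: scaleR_nonneg_nonneg)
      have "ideal_part g' y' u \<le> 0"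
      proof (rule ideal_part_least[OF g(2) y(2)])
        fix s :: real assume s: "0 \<le> s"
        have "inf u (s *\<^sub>R y') = 0"
          by (rule disjoint_mono[OF disjoint_scaleR[OF yy' r(1) s] u(1,3)])
            (simp_all add: scaleR_nonneg_nonneg s y)
        then have "inf \<bar>u\<bar> (s *\<^sub>R y') = 0"
          by (simp only: abs_of_nonneg[OF u(1)])
        then show "dual_apply g' (inf \<bar>u\<bar> (s *\<^sub>R y')) \<le> 0"
          by (simp add: dual.zero_right)
      qed
      then have "dual_apply \<bar>h'\<bar> u \<le> 0"
        using h'[OF u(1)] by simp
      moreover have "dual_apply \<bar>h\<bar> (x - u) \<le> \<delta>"
        using order_trans[OF h r(2)] u(2) by (simp only: u_def diff_ge_0_iff_ge)
      moreover have "dual_apply (inf \<bar>h\<bar> \<bar>h'\<bar>) (x - u) \<le> dual_apply \<bar>h\<bar> (x - u)"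
        "dual_apply (inf \<bar>h\<bar> \<bar>h'\<bar>) u \<le> dual_apply \<bar>h'\<bar> u"
        using u by (auto intro: dual_apply_mono_fun)
      ultimately show "dual_apply (inf \<bar>h\<bar> \<bar>h'\<bar>) x \<le> dual_apply 0 x + \<delta>"
        by (simp add: dual.diff_right)
    qed
  qed
qed simp

text \<open>Intended for \<open>\<bar>y k\<bar> \<le> \<bar>z k\<bar>\<close>: the infimum is then
  \<open>\<bar>y k\<bar>\<close>, so the disjoint \<open>h k\<close> retain at \<open>z k\<close>
  the full value of \<open>g k\<close> at \<open>\<bar>y k\<bar>\<close>.\<close>

lemma ex_disjoint_functionals:
  fixes g :: "nat \<Rightarrow> 'a::banach_lattice dual"
  assumes g: "\<And>k. 0 \<le> g k" and y: "disjoint_seq y"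
  obtains h where "\<And>k. \<bar>h k\<bar> \<le> g k" "disjoint_seq h"
    "\<And>k. dual_apply (g k) (inf \<bar>z k\<bar> \<bar>y k\<bar>) \<le> dual_apply (h k) (z k)"
proof -
  have "\<exists>h. \<bar>h\<bar> \<le> g k \<and> (\<forall>x. 0 \<le> x \<longrightarrow> dual_apply \<bar>h\<bar> x \<le> ideal_part (g k) \<bar>y k\<bar> x)
      \<and> dual_apply (g k) (inf \<bar>z k\<bar> \<bar>y k\<bar>) \<le> dual_apply h (z k)" for k
    using ex_dual_ideal_part[OF g abs_ge_zero, of k "y k" "z k"] by metis
  then obtain h where h: "\<And>k. \<bar>h k\<bar> \<le> g k"
    "\<And>k x. 0 \<le> x \<Longrightarrow> dual_apply \<bar>h k\<bar> x \<le> ideal_part (g k) \<bar>y k\<bar> x"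
    "\<And>k. dual_apply (g k) (inf \<bar>z k\<bar> \<bar>y k\<bar>) \<le> dual_apply (h k) (z k)"
    by metis
  moreover have "disjoint_seq h"
    unfolding disjoint_seq_def
  proof (intro allI impI)
    fix m n :: nat assume "m \<noteq> n"
    then have "inf \<bar>y m\<bar> \<bar>y n\<bar> = 0"
      using y by (simp add: disjoint_seq_def)
    then show "inf \<bar>h m\<bar> \<bar>h n\<bar> = 0"
      using g h(2) by (intro disjoint_ideal_parts[of "g m" "g n" "\<bar>y m\<bar>" "\<bar>y n\<bar>"])
  qed
  ultimately show thesis
    by (intro that)
qed

text \<open>Hahn-Banach for the norm of the positive part. This gauge vanishes at \<open>- x\<close>
  for \<open>0 \<le> x\<close>, so a functional below it is positive.\<close>

lemma ex_norming_functional: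
  fixes y :: "'a::banach_lattice"
  assumes y: "0 \<le> y"
  obtains g where "0 \<le> g" "norm g \<le> 1" "dual_apply g y = norm y"
proof -
  have "sublinear (\<lambda>x :: 'a. norm (pprt x))"
  proof (rule sublinearI)
    fix u v :: 'a
    have "norm (pprt (u + v)) \<le> norm (pprt u + pprt v)"
    proof (rule norm_mono_nonneg)
      show "pprt (u + v) \<le> pprt u + pprt v"
        using add_mono[OF le_pprt le_pprt, of u v] unfolding pprt_def[of "u + v"]
        by (intro sup_least) auto
    qed simp
    also have "\<dots> \<le> norm (pprt u) + norm (pprt v)"
      by (rule norm_triangle_ineq)
    finally show "norm (pprt (u + v)) \<le> norm (pprt u) + norm (pprt v)" .
  next
    fix c :: real and u :: 'a assume c: "0 < c"
    have "norm (pprt (c *\<^sub>R u)) \<le> norm (c *\<^sub>R pprt u)"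
    proof (rule norm_mono_nonneg)
      show "pprt (c *\<^sub>R u) \<le> c *\<^sub>R pprt u"
        using scaleR_left_mono[OF le_pprt, of c u] c unfolding pprt_def[of "c *\<^sub>R u"]
        by (intro sup_least) (auto intro: scaleR_nonneg_nonneg)
    qed simp
    then show "norm (pprt (c *\<^sub>R u)) \<le> c * norm (pprt u)"
      using c by simp
  qed simp
  moreover have bound: "norm (pprt x) \<le> 1 * norm x" for x :: 'a
    using norm_mono_nonneg[of "pprt x" "\<bar>x\<bar>"] by (simp add: abs_prts[of x] norm_abs[of x, unfolded abs_prts])
  ultimately obtain g where g: "\<And>x. dual_apply g x \<le> norm (pprt x)"
    and gy: "dual_apply g y = norm (pprt y)"
    using ex_dual_dominated by metis
  have "0 \<le> g"
    unfolding less_eq_dual_def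
  proof (intro allI impI)
    fix x :: 'a assume "0 \<le> x"
    then show "dual_apply 0 x \<le> dual_apply g x"
      using g[of "- x"] by (simp add: dual.minus_right)
  qed
  moreover have "norm g \<le> 1"
  proof (rule norm_dual_bound)
    show "\<bar>dual_apply g x\<bar> \<le> 1 * norm x" for x
      using g[of x] g[of "- x"] bound[of x] bound[of "- x"] by (simp add: dual.minus_right abs_le_iff)
  qed simp
  ultimately show thesis
    using that gy y by simp
qed


section \<open>Extracting disjoint sequences\<close>

lemma member_le_sum_nonneg:
  fixes g :: "'b \<Rightarrow> 'a::banach_lattice"
  assumes "finite J" "j \<in> J" "\<And>i. i \<in> J \<Longrightarrow> 0 \<le> g i"
  shows "g j \<le> sum g J"
  using sum_mono2[of J "{j}" g] assms by simp

text \<open>Induction on \<open>J\<close>: a first split puts nearly all of \<open>f n\<close> on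
  \<open>y\<close> and nearly all of the other functionals on \<open>u - y\<close>, which is divided
  further with half the tolerance.\<close>

lemma disjoint_functionals_split:
  fixes f :: "nat \<Rightarrow> 'a::banach_lattice dual"
  assumes "finite J" and f: "\<And>j. 0 \<le> f j" "\<And>i j. i \<noteq> j \<Longrightarrow> inf (f i) (f j) = 0"
    and "0 \<le> u" "0 < \<eta>"
  shows "\<exists>z. (\<forall>j\<in>J. 0 \<le> z j \<and> dual_apply (f j) u - \<eta> \<le> dual_apply (f j) (z j)) \<and> sum z J \<le> u"
  using assms(1,4,5)
proof (induction J arbitrary: u \<eta> rule: finite_induct)
  case (insert n J)
  have "inf (f n) (sum f J) = 0"
    using insert.hyps by (intro disjoint_sum f) (auto intro!: f)
  then obtain y where y: "0 \<le> y" "y \<le> u"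
    and split: "dual_apply (f n) (u - y) + dual_apply (sum f J) y < \<eta> / 2"
    using disjoint_dual_split[of "f n" "sum f J" u "\<eta> / 2"] insert.prems by auto
  have small: "0 \<le> dual_apply (f n) (u - y)" "0 \<le> dual_apply (sum f J) y"
    using f y by (auto intro!: dual_apply_nonneg sum_nonneg)
  obtain z where z: "\<And>j. j \<in> J \<Longrightarrow> 0 \<le> z j"
    "\<And>j. j \<in> J \<Longrightarrow> dual_apply (f j) (u - y) - \<eta> / 2 \<le> dual_apply (f j) (z j)" "sum z J \<le> u - y"
    using insert.IH[of "u - y" "\<eta> / 2"] insert.prems y by auto
  have "dual_apply (f j) u - \<eta> \<le> dual_apply (f j) (z j)" if j: "j \<in> J" for j
  proof -
    have "dual_apply (f j) y \<le> dual_apply (sum f J) y"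
      using insert.hyps(1) f(1) y(1) j unfolding dual.sum_left
      by (intro member_le_sum) (auto intro: dual_apply_nonneg)
    then show ?thesis
      using z(2)[OF j] split small by (simp add: dual.diff_right)
  qed
  moreover have "dual_apply (f n) u - \<eta> \<le> dual_apply (f n) y"
    using split small insert.prems by (simp add: dual.diff_right)
  moreover have "sum (z(n := y)) (insert n J) \<le> u"
  proof -
    have "sum (z(n := y)) J = sum z J"
      using insert.hyps(2) by (intro sum.cong) auto
    then show ?thesis
      using insert.hyps z(3) by (simp add: algebra_simps)
  qed
  ultimately show ?case
    using y z insert.hyps(2) by (intro exI[of _ "z(n := y)"]) auto
qed simp

text \<open>Each \<open>d k\<close> is cut down by \<open>s k\<close>, whose first term handles the
  earlier vectors and whose second term the later ones. By \<open>fd\<close> and \<open>fw\<close>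
  these terms cost at most \<open>\<epsilon>\<close> each.\<close>

lemma disjointification:
  fixes f :: "nat \<Rightarrow> 'a::banach_lattice dual" and d :: "nat \<Rightarrow> 'a"
  assumes f: "\<And>k. 0 \<le> f k" and d: "\<And>k. 0 \<le> d k" and w: "0 \<le> w"
    and c: "\<And>k. 0 < c k" "\<And>k. d k \<le> c k *\<^sub>R w" and L: "0 < L"
    and fw: "\<And>k. dual_apply (f k) w \<le> L * \<epsilon>"
    and fd: "\<And>k. c k * L * dual_apply (f k) (\<Sum>i<k. d i) \<le> \<epsilon>"
  obtains v where "disjoint_seq v" "\<And>k. 0 \<le> v k" "\<And>k. v k \<le> d k"
    "\<And>k. dual_apply (f k) (d k) - 2 * \<epsilon> \<le> dual_apply (f k) (v k)"
proof -
  define s where "s k = (c k * L) *\<^sub>R (\<Sum>i<k. d i) + inverse L *\<^sub>R w" for k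
  define v where "v k = pprt (d k - s k)" for k
  have s: "0 \<le> s k" for k
    unfolding s_def using c(1) L w d
    by (intro add_nonneg_nonneg scaleR_nonneg_nonneg sum_nonneg) (auto simp: less_imp_le)
  have v: "0 \<le> v k" "v k \<le> d k" for k
    unfolding v_def using pprt_diff_le[OF d s] by auto
  have disj: "inf (v i) (v k) = 0" if "i < k" for i k
  proof -
    define K where "K = c k * L"
    have K: "0 < K"
      using c(1) L by (simp add: K_def)
    \<comment> \<open>For \<open>i < k\<close> the vector \<open>v k\<close> lies below
      \<open>pprt a\<close> and \<open>v i\<close> below a multiple of \<open>pprt (- a)\<close>,
      the latter because \<open>d k\<close> divided by \<open>K\<close> is at most
      \<open>inverse L *\<^sub>R w\<close>.\<close>
    define a where "a = d k - K *\<^sub>R d i"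
    have "d i \<le> (\<Sum>j<k. d j)"
      using that d by (intro member_le_sum_nonneg) auto
    then have "K *\<^sub>R d i \<le> K *\<^sub>R (\<Sum>j<k. d j)"
      using K by (intro scaleR_left_mono) auto
    also have "\<dots> \<le> s k"
      using w L by (auto simp: s_def K_def intro!: scaleR_nonneg_nonneg)
    finally have vk: "v k \<le> pprt a"
      unfolding v_def a_def by (intro pprt_mono diff_left_mono)
    have "inverse K *\<^sub>R d k \<le> inverse K *\<^sub>R (c k *\<^sub>R w)"
      using K c(2) by (intro scaleR_left_mono) auto
    also have "\<dots> = inverse L *\<^sub>R w"
      using c(1)[of k] L by (simp add: K_def field_simps)
    also have "\<dots> \<le> s i"
      unfolding s_def using c(1) L d
      by (auto intro!: scaleR_nonneg_nonneg sum_nonneg simp: less_imp_le)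
    finally have "d i - s i \<le> d i - inverse K *\<^sub>R d k"
      by (intro diff_left_mono)
    also have "\<dots> = inverse K *\<^sub>R (- a)"
      using K by (simp add: a_def algebra_simps)
    also have "\<dots> \<le> inverse K *\<^sub>R pprt (- a)"
      using K by (intro scaleR_left_mono le_pprt) auto
    finally have vi: "v i \<le> inverse K *\<^sub>R pprt (- a)"
      unfolding v_def pprt_def[of "d i - s i"] using K
      by (intro sup_least) (auto intro: scaleR_nonneg_nonneg)
    have "inf (1 *\<^sub>R pprt a) (inverse K *\<^sub>R pprt (- a)) = 0"
      using K by (intro disjoint_scaleR inf_pprt_uminus) auto
    then have "inf (v k) (v i) = 0"
      unfolding scaleR_one by (rule disjoint_mono[OF _ v(1) vk v(1) vi])
    then show ?thesis
      by (simp add: inf_commute)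
  qed
  have "disjoint_seq v"
    unfolding disjoint_seq_def
  proof (intro allI impI)
    fix i k :: nat assume "i \<noteq> k"
    then have "inf (v i) (v k) = 0"
      using disj[of i k] disj[of k i] by (metis inf_commute linorder_neqE_nat)
    then show "inf \<bar>v i\<bar> \<bar>v k\<bar> = 0"
      by (simp only: abs_of_nonneg v(1))
  qed
  moreover have "dual_apply (f k) (d k) - 2 * \<epsilon> \<le> dual_apply (f k) (v k)" for k
  proof -
    have "inverse L * dual_apply (f k) w \<le> \<epsilon>"
      using fw[of k] L by (simp add: field_simps)
    then have "dual_apply (f k) (s k) \<le> \<epsilon> + \<epsilon>"
      using fd[of k] unfolding s_def dual.add_right dual.scaleR_right by simp
    moreover have "dual_apply (f k) (d k - s k) \<le> dual_apply (f k) (v k)"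
      unfolding v_def by (intro dual_apply_mono f le_pprt)
    ultimately show ?thesis
      by (simp add: dual.diff_right)
  qed
  ultimately show thesis
    using that v by blast
qed

text \<open>From \<open>0 \<le> a n\<close> follows
  \<open>pprt (- l) \<le> \<bar>a n - l\<bar>\<close>, and the right-hand side tends to 0 in
  norm.\<close>

lemma nonneg_limit:
  fixes a :: "nat \<Rightarrow> 'a::banach_lattice"
  assumes "a \<longlonglongrightarrow> l" and ev: "\<forall>\<^sub>F n in sequentially. 0 \<le> a n"
  shows "0 \<le> l"
proof -
  have "norm (pprt (- l)) \<le> 0"
  proof (rule tendsto_lowerbound)
    show "(\<lambda>n. norm (a n - l)) \<longlonglongrightarrow> 0"
      using assms(1) by (simp add: LIM_zero tendsto_norm_zero)
    show "\<forall>\<^sub>F n in sequentially. norm (pprt (- l)) \<le> norm (a n - l)"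
      using ev
    proof eventually_elim
      case (elim n)
      then have "pprt (- l) \<le> pprt (a n - l)"
        by (intro pprt_mono) simp
      also have "\<dots> \<le> \<bar>a n - l\<bar>"
        using abs_ge_self[of "a n - l"] unfolding pprt_def by (intro sup_least) auto
      finally show ?case
        using norm_mono_nonneg[of "pprt (- l)" "\<bar>a n - l\<bar>"] by (simp add: norm_abs)
    qed
  qed simp
  then show ?thesis
    by (simp add: pprt_neg zero_le_iff_zero_nprt)
qed

text \<open>For positive \<open>f\<close>, \<open>\<bar>dual_apply f x\<bar>\<close> is at most the
  value at \<open>\<bar>x\<bar>\<close>, which has the same norm; so positive vectors of the unit
  ball suffice to compute \<open>norm f\<close>.\<close>

lemma ex_almost_norming:
  fixes f :: "'a::banach_lattice dual"
  assumes f: "0 \<le> f" and r: "0 \<le> r" "r < norm f"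
  obtains x where "0 \<le> x" "norm x \<le> 1" "r \<le> dual_apply f x"
proof -
  have "\<exists>x. 0 \<le> x \<and> norm x \<le> 1 \<and> r \<le> dual_apply f x"
  proof (rule ccontr)
    assume none: "\<not> ?thesis"
    have "norm f \<le> r"
    proof (rule norm_dual_bound[OF r(1)])
      fix x
      show "\<bar>dual_apply f x\<bar> \<le> r * norm x"
      proof (cases "x = 0")
        case False
        define z where "z = inverse (norm x) *\<^sub>R \<bar>x\<bar>"
        have "0 \<le> z" "norm z \<le> 1"
          using False by (auto simp: z_def norm_abs intro: scaleR_nonneg_nonneg)
        then have "dual_apply f z < r"
          using none by force
        then have "dual_apply f \<bar>x\<bar> \<le> r * norm x"
          using False by (simp add: z_def dual.scaleR_right field_simps)
        then show ?thesis
          using abs_dual_apply[of f x] unfolding abs_of_nonneg[OF f] by linarith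
      qed (simp add: dual.zero_right)
    qed
    then show False
      using r(2) by simp
  qed
  then show thesis
    using that by blast
qed

lemma infinite_not_null:
  fixes a :: "nat \<Rightarrow> real"
  assumes "\<And>n. 0 \<le> a n" "\<not> a \<longlonglongrightarrow> 0"
  obtains \<epsilon> where "0 < \<epsilon>" "infinite {n. \<epsilon> \<le> a n}"
proof -
  obtain \<epsilon> where "0 < \<epsilon>" "\<And>N. \<exists>n\<ge>N. \<epsilon> \<le> a n"
    using assms unfolding LIMSEQ_def by (force simp: not_less)
  then show thesis
    using that by (auto simp: infinite_nat_iff_unbounded_le)
qed

section \<open>Disjoint positive functionals tested on disjoint bounded sequences\<close>

context
  fixes f :: "nat \<Rightarrow> 'a::banach_lattice dual" and C :: real
  assumes f_nonneg: "\<And>k. 0 \<le> f k" and f_disjoint: "\<And>i j. i \<noteq> j \<Longrightarrow> inf (f i) (f j) = 0"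
    and f_bound: "\<And>k. norm (f k) \<le> C"
    and f_null: "\<And>x n. disjoint_seq x \<Longrightarrow> (\<And>k. 0 \<le> x k) \<Longrightarrow> bounded (range x) \<Longrightarrow>
      (\<lambda>k. dual_apply (f (n k)) (x k)) \<longlonglongrightarrow> 0"
begin

lemma f_apply_le: "dual_apply (f k) x \<le> C * norm x"
  using norm_dual_apply[of "f k" x] mult_right_mono[OF f_bound norm_ge_zero, of k x] by linarith

text \<open>Disjointification loses \<open>2 * \<epsilon>\<close> out of at least
  \<open>3 * \<epsilon>\<close>, leaving a disjoint bounded sequence on which the functionals stay
  above \<open>\<epsilon>\<close>, against \<open>f_null\<close>.\<close>

lemma no_large_disjoint:
  fixes d :: "nat \<Rightarrow> 'a"
  assumes d: "\<And>k. 0 \<le> d k" "\<And>k. norm (d k) \<le> b" and w: "0 \<le> w"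
    and c: "\<And>k. 0 < c k" "\<And>k. d k \<le> c k *\<^sub>R w" and L: "0 < L" "C * norm w \<le> L * \<epsilon>"
    and fd: "\<And>k. c k * L * dual_apply (f (n k)) (\<Sum>i<k. d i) \<le> \<epsilon>"
    and large: "\<And>k. 3 * \<epsilon> \<le> dual_apply (f (n k)) (d k)" and \<epsilon>: "0 < \<epsilon>"
  shows False
proof -
  have "dual_apply (f (n k)) w \<le> L * \<epsilon>" for k
    using f_apply_le L(2) by (rule order_trans)
  then obtain v where v: "disjoint_seq v" "\<And>k. 0 \<le> v k" "\<And>k. v k \<le> d k"
    and fv: "\<And>k. dual_apply (f (n k)) (d k) - 2 * \<epsilon> \<le> dual_apply (f (n k)) (v k)"
    using disjointification[of "\<lambda>k. f (n k)" d w c L \<epsilon>] f_nonneg d(1) w c L(1) fd by metis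
  have "norm (v k) \<le> b" for k
    using norm_mono_nonneg[OF v(2,3)] d(2) by (rule order_trans)
  then have "bounded (range v)"
    by (auto simp: bounded_iff)
  then have "(\<lambda>k. dual_apply (f (n k)) (v k)) \<longlonglongrightarrow> 0"
    using v by (intro f_null)
  then have "\<epsilon> \<le> 0"
  proof (rule tendsto_lowerbound)
    have "\<epsilon> \<le> dual_apply (f (n k)) (v k)" for k
      using fv[of k] large[of k] by simp
    then show "\<forall>\<^sub>F k in sequentially. \<epsilon> \<le> dual_apply (f (n k)) (v k)"
      by simp
  qed simp
  then show False
    using \<epsilon> by simp
qed

text \<open>Splitting \<open>u\<close> into \<open>N\<close> parts on which \<open>N\<close> different functionals are large, every other
  functional is small, of order \<open>1/N\<close>, on one of the parts; by the pigeonhole principle the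
  same part works for infinitely many functionals.\<close>

lemma ex_small_part:
  assumes I: "infinite I" "\<And>n. n \<in> I \<Longrightarrow> 2 * \<epsilon> \<le> dual_apply (f n) u"
    and u: "0 \<le> u" and \<epsilon>: "0 < \<epsilon>" and \<delta>: "0 < \<delta>"
  obtains n d I' where "n \<in> I" "0 \<le> d" "d \<le> u" "\<epsilon> \<le> dual_apply (f n) d"
    "infinite I'" "I' \<subseteq> I" "\<And>m. m \<in> I' \<Longrightarrow> dual_apply (f m) d \<le> \<delta>"
proof -
  \<comment> \<open>Values above \<open>\<delta>\<close> on all \<open>N\<close> parts would add up
    to more than \<open>C * norm u\<close>, the bound for every functional at
    \<open>u\<close>.\<close>
  obtain N :: nat where N: "C * norm u < N * \<delta>"
    using \<delta> by (metis reals_Archimedean3 mult.commute)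
  obtain J where J: "J \<subseteq> I" "finite J" "card J = N"
    using I(1) infinite_arbitrarily_large by metis
  obtain z where z: "\<And>j. j \<in> J \<Longrightarrow> 0 \<le> z j"
    "\<And>j. j \<in> J \<Longrightarrow> dual_apply (f j) u - \<epsilon> \<le> dual_apply (f j) (z j)" "sum z J \<le> u"
    using disjoint_functionals_split[where f = f, OF J(2) f_nonneg f_disjoint u \<epsilon>] by blast
  have "\<exists>j\<in>J. dual_apply (f m) (z j) \<le> \<delta>" for m
  proof (rule ccontr)
    assume "\<not> ?thesis"
    then have "(\<Sum>j\<in>J. \<delta>) \<le> (\<Sum>j\<in>J. dual_apply (f m) (z j))"
      by (intro sum_mono) auto
    also have "\<dots> = dual_apply (f m) (sum z J)"
      by (simp add: dual.sum_right)
    also have "\<dots> \<le> dual_apply (f m) u"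
      using z(3) by (intro dual_apply_mono f_nonneg)
    also have "\<dots> \<le> C * norm u"
      by (rule f_apply_le)
    finally show False
      using N J(3) by simp
  qed
  then have "I = (\<Union>j\<in>J. {m \<in> I. dual_apply (f m) (z j) \<le> \<delta>})"
    by auto
  then obtain j where j: "j \<in> J" "infinite {m \<in> I. dual_apply (f m) (z j) \<le> \<delta>}"
    using I(1) J(2) by (metis (no_types, lifting) finite_UN)
  have "z j \<le> sum z J"
    using J(2) j(1) z(1) by (intro member_le_sum_nonneg)
  then have "z j \<le> u"
    using z(3) by (rule order_trans)
  moreover have "\<epsilon> \<le> dual_apply (f j) (z j)"
    using z(2)[OF j(1)] I(2)[of j] J(1) j(1) by auto
  ultimately show thesis
    using j(1) J(1) by (intro that[OF _ z(1)[OF j(1)] _ _ j(2)]) blast+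
qed

text \<open>Otherwise \<open>ex_small_part\<close> can be iterated along nested infinite index sets,
  so that each chosen functional is large on its own part of \<open>u\<close> and small on all
  earlier parts. The parts lie below \<open>u\<close>, which serves as \<open>w\<close> with all
  factors \<open>c\<close> equal to 1.\<close>

lemma disjoint_functionals_weak_star_null:
  assumes u: "0 \<le> u"
  shows "(\<lambda>k. dual_apply (f k) u) \<longlonglongrightarrow> 0"
proof (rule ccontr)
  assume "\<not> ?thesis"
  then obtain \<epsilon>' where \<epsilon>': "0 < \<epsilon>'" "infinite {n. \<epsilon>' \<le> dual_apply (f n) u}"
    using infinite_not_null[of "\<lambda>k. dual_apply (f k) u"] dual_apply_nonneg[OF f_nonneg u] by metis
  \<comment> \<open>Choosing a part halves \<open>6 * \<epsilon>\<close>, and the remaining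
    \<open>3 * \<epsilon>\<close> is what \<open>no_large_disjoint\<close> asks for.\<close>
  define \<epsilon> where "\<epsilon> = \<epsilon>' / 6"
  have \<epsilon>: "0 < \<epsilon>"
    using \<epsilon>' by (simp add: \<epsilon>_def)
  define I0 where "I0 = {n. 2 * (3 * \<epsilon>) \<le> dual_apply (f n) u}"
  have I0: "infinite I0" "\<And>n. n \<in> I0 \<Longrightarrow> 2 * (3 * \<epsilon>) \<le> dual_apply (f n) u"
    using \<epsilon>' by (auto simp: I0_def \<epsilon>_def)
  have C: "0 \<le> C"
    using f_bound[of 0] norm_ge_zero order_trans by blast
  \<comment> \<open>The summand 1 keeps \<open>L\<close> positive even when
    \<open>C * norm u\<close> is 0.\<close>
  define L where "L = C * norm u / \<epsilon> + 1"
  have L: "0 < L" "C * norm u \<le> L * \<epsilon>"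
    using \<epsilon> C by (auto simp: L_def distrib_right intro!: add_nonneg_pos)
  \<comment> \<open>Geometric weights with total at most \<open>\<epsilon> / L\<close>, the bound
    needed for the sum over all earlier parts.\<close>
  define \<delta> where "\<delta> k = \<epsilon> / (2 * L) * (1 / 2) ^ k" for k :: nat
  have \<delta>: "0 < \<delta> k" for k
    using \<epsilon> L by (simp add: \<delta>_def)
  have \<delta>_sum: "sum \<delta> {..<k} \<le> \<epsilon> / L" for k
  proof -
    have "sum \<delta> {..<k} = \<epsilon> / (2 * L) * (\<Sum>i<k. (1 / 2) ^ i)"
      by (simp add: \<delta>_def sum_distrib_left)
    also have "(\<Sum>i<k. (1 / 2 :: real) ^ i) = 2 * (1 - (1 / 2) ^ k)"
      by (simp add: geometric_sum)
    also have "\<epsilon> / (2 * L) * (2 * (1 - (1 / 2) ^ k)) \<le> \<epsilon> / (2 * L) * 2"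
      using \<epsilon> L by (intro mult_left_mono) auto
    finally show ?thesis
      by simp
  qed
  \<comment> \<open>A state consists of the chosen index, its part of \<open>u\<close>, and the
    index set left for later choices.\<close>
  define P where "P k s \<longleftrightarrow> (case s of (n, d, I) \<Rightarrow> infinite I \<and> I \<subseteq> I0 \<and> 0 \<le> d \<and> d \<le> u \<and>
    3 * \<epsilon> \<le> dual_apply (f n) d \<and> (\<forall>m\<in>I. dual_apply (f m) d \<le> \<delta> k))"
    for k and s :: "nat \<times> 'a \<times> nat set"
  define Q where "Q s s' \<longleftrightarrow> (case (s, s') of ((n, d, I), (n', d', I')) \<Rightarrow> n' \<in> I \<and> I' \<subseteq> I)"
    for s s' :: "nat \<times> 'a \<times> nat set"
  have step: "\<exists>n d I'. n \<in> I \<and> I' \<subseteq> I \<and> P k (n, d, I')" if I: "infinite I" "I \<subseteq> I0" for k I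
  proof -
    have I_large: "\<And>n. n \<in> I \<Longrightarrow> 2 * (3 * \<epsilon>) \<le> dual_apply (f n) u"
      using I(2) I0(2) by blast
    obtain n d I' where "n \<in> I" "0 \<le> d" "d \<le> u" "3 * \<epsilon> \<le> dual_apply (f n) d"
      "infinite I'" "I' \<subseteq> I" "\<And>m. m \<in> I' \<Longrightarrow> dual_apply (f m) d \<le> \<delta> k"
      by (rule ex_small_part[OF I(1) I_large u _ \<delta>[of k]]) (use \<epsilon> in auto)
    then show ?thesis
      using I(2) unfolding P_def by blast
  qed
  have "\<exists>S. \<forall>k. P k (S k) \<and> Q (S k) (S (Suc k))"
  proof (rule dependent_nat_choice)
    show "\<exists>s. P 0 s"
      using step[OF I0(1)] by blast
    fix s k assume "P k s"
    then obtain n d I where s: "s = (n, d, I)" "infinite I" "I \<subseteq> I0"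
      unfolding P_def by (cases s) auto
    then show "\<exists>s'. P (Suc k) s' \<and> Q s s'"
      using step[OF s(2,3), of "Suc k"] by (auto simp: Q_def)
  qed
  then obtain S where PS: "\<And>k. P k (S k)" and QS: "\<And>k. Q (S k) (S (Suc k))"
    by blast
  define n d I where "n k = fst (S k)" and "d k = fst (snd (S k))" and "I k = snd (snd (S k))" for k
  have S: "S k = (n k, d k, I k)" for k
    by (simp add: n_def d_def I_def)
  have d: "0 \<le> d k" "d k \<le> u" and large: "3 * \<epsilon> \<le> dual_apply (f (n k)) (d k)"
    and small: "\<And>m. m \<in> I k \<Longrightarrow> dual_apply (f m) (d k) \<le> \<delta> k" for k
    using PS[of k] by (auto simp: P_def S)
  have nI: "n (Suc k) \<in> I k" "I (Suc k) \<subseteq> I k" for k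
    using QS[of k] by (auto simp: Q_def S)
  have nI_less: "n k \<in> I i" if "i < k" for i k
  proof -
    have "I (k - 1) \<subseteq> I i"
      by (rule lift_Suc_antimono_le) (use nI(2) that in auto)
    then show ?thesis
      using nI(1)[of "k - 1"] that by auto
  qed
  show False
  proof (rule no_large_disjoint[where d = d and n = n and w = u and c = "\<lambda>_. 1" and L = L and \<epsilon> = \<epsilon>])
    fix k
    have "dual_apply (f (n k)) (\<Sum>i<k. d i) = (\<Sum>i<k. dual_apply (f (n k)) (d i))"
      by (rule dual.sum_right)
    also have "\<dots> \<le> sum \<delta> {..<k}"
      using nI_less by (intro sum_mono small) auto
    also have "\<dots> \<le> \<epsilon> / L"
      by (rule \<delta>_sum)
    finally show "1 * L * dual_apply (f (n k)) (\<Sum>i<k. d i) \<le> \<epsilon>"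
      using L by (simp add: field_simps)
    show "norm (d k) \<le> norm u"
      by (rule norm_mono_nonneg[OF d])
  qed (use d large u L \<epsilon> in auto)
qed

text \<open>Nearly norming vectors \<open>d k\<close> need not have a common upper bound, so
  \<open>w\<close> is the series of the vectors \<open>d k\<close> divided by \<open>2 ^ k\<close>,
  with factors \<open>c k = 2 ^ k\<close>. Weak-star convergence to 0 allows each new functional to
  be chosen small on the sum of the earlier vectors, even after multiplication by its
  factor.\<close>

lemma disjoint_functionals_norm_null: "(\<lambda>k. norm (f k)) \<longlonglongrightarrow> 0"
proof (rule ccontr)
  assume "\<not> ?thesis"
  then obtain \<epsilon>' where \<epsilon>': "0 < \<epsilon>'" "infinite {n. \<epsilon>' \<le> norm (f n)}"
    using infinite_not_null[of "\<lambda>k. norm (f k)"] by auto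
  \<comment> \<open>This leaves \<open>3 * \<epsilon>\<close> strictly below norms of at least
    \<open>4 * \<epsilon>\<close>, as \<open>ex_almost_norming\<close> requires.\<close>
  define \<epsilon> where "\<epsilon> = \<epsilon>' / 4"
  have \<epsilon>: "0 < \<epsilon>"
    using \<epsilon>' by (simp add: \<epsilon>_def)
  define I where "I = {n. 4 * \<epsilon> \<le> norm (f n)}"
  have I: "infinite I"
    using \<epsilon>' by (simp add: I_def \<epsilon>_def)
  have "\<exists>x. 0 \<le> x \<and> norm x \<le> 1 \<and> 3 * \<epsilon> \<le> dual_apply (f n) x" if "n \<in> I" for n
    using that \<epsilon> ex_almost_norming[OF f_nonneg, of "3 * \<epsilon>" n] unfolding I_def by force
  then obtain x where x: "\<And>n. n \<in> I \<Longrightarrow> 0 \<le> x n" "\<And>n. n \<in> I \<Longrightarrow> norm (x n) \<le> 1"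
    "\<And>n. n \<in> I \<Longrightarrow> 3 * \<epsilon> \<le> dual_apply (f n) (x n)"
    by metis
  have C: "0 \<le> C"
    using f_bound[of 0] norm_ge_zero order_trans by blast
  \<comment> \<open>The 2 anticipates the bound for \<open>norm w\<close>.\<close>
  define L where "L = C * 2 / \<epsilon> + 1"
  have L: "0 < L" "C * 2 \<le> L * \<epsilon>"
    using \<epsilon> C by (auto simp: L_def distrib_right intro!: add_nonneg_pos)
  \<comment> \<open>A state consists of the chosen index and the sum of all chosen vectors, the
    newest included. Hence \<open>Q\<close> carries the factor \<open>2 ^ Suc k\<close> of the next
    index.\<close>
  define P where "P k s \<longleftrightarrow> (case s of (n, S) \<Rightarrow> n \<in> I \<and> 0 \<le> S \<and> (k = 0 \<longrightarrow> S = x n))"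
    for k :: nat and s :: "nat \<times> 'a"
  define Q where "Q k s s' \<longleftrightarrow> (case (s, s') of ((n, S), (n', S')) \<Rightarrow>
      S' = S + x n' \<and> 2 ^ Suc k * L * dual_apply (f n') S \<le> \<epsilon>)"
    for k :: nat and s s' :: "nat \<times> 'a"
  have "\<exists>s. \<forall>k. P k (s k) \<and> Q k (s k) (s (Suc k))"
  proof (rule dependent_nat_choice)
    obtain n where "n \<in> I"
      using I by (metis finite.emptyI all_not_in_conv)
    then show "\<exists>s. P 0 s"
      using x(1) by (intro exI[of _ "(n, x n)"]) (simp add: P_def)
    fix s k assume "P k s"
    then obtain n S where s: "s = (n, S)" "0 \<le> S"
      by (auto simp: P_def split: prod.splits)
    have "(\<lambda>m. 2 ^ Suc k * L * dual_apply (f m) S) \<longlonglongrightarrow> 2 ^ Suc k * L * 0"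
      by (intro tendsto_mult_left disjoint_functionals_weak_star_null s(2))
    then have "\<forall>\<^sub>F m in sequentially. 2 ^ Suc k * L * dual_apply (f m) S < \<epsilon>"
      using \<epsilon> by (intro order_tendstoD) auto
    then obtain N where N: "\<And>m. m \<ge> N \<Longrightarrow> 2 ^ Suc k * L * dual_apply (f m) S < \<epsilon>"
      by (auto simp: eventually_sequentially)
    obtain m where "m \<ge> N" "m \<in> I"
      using I by (auto simp: infinite_nat_iff_unbounded_le)
    then show "\<exists>s'. P (Suc k) s' \<and> Q k s s'"
      using N[of m] s x(1)[of m] by (intro exI[of _ "(m, S + x m)"]) (auto simp: P_def Q_def)
  qed
  then obtain s where Ps: "\<And>k. P k (s k)" and Qs: "\<And>k. Q k (s k) (s (Suc k))"
    by blast
  define n S where "n k = fst (s k)" and "S k = snd (s k)" for k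
  have s: "s k = (n k, S k)" for k
    by (simp add: n_def S_def)
  have nI: "n k \<in> I" for k
    using Ps[of k] by (auto simp: P_def s)
  have S0: "S 0 = x (n 0)"
    using Ps[of 0] by (auto simp: P_def s)
  have S_Suc: "S (Suc k) = S k + x (n (Suc k))"
    and S_small: "2 ^ Suc k * L * dual_apply (f (n (Suc k))) (S k) \<le> \<epsilon>" for k
    using Qs[of k] by (auto simp: Q_def s)
  define d where "d k = x (n k)" for k
  have d: "0 \<le> d k" "norm (d k) \<le> 1" "3 * \<epsilon> \<le> dual_apply (f (n k)) (d k)" for k
    using x nI by (auto simp: d_def)
  have S_sum: "S k = (\<Sum>i<Suc k. d i)" for k
    by (induction k) (simp_all add: S0 S_Suc d_def)
  define a where "a k = (1 / 2 :: real) ^ k *\<^sub>R d k" for k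
  have a: "0 \<le> a k" for k
    using d by (auto simp: a_def intro: scaleR_nonneg_nonneg)
  have a_norm: "norm (a k) \<le> (1 / 2) ^ k" for k
    using d(2)[of k] by (simp add: a_def field_simps)
  have summ: "summable (\<lambda>k. norm (a k))"
    by (rule summable_comparison_test'[where g = "\<lambda>k. (1 / 2) ^ k" and N = 0]) (use a_norm in auto)
  define w where "w = suminf a"
  have a_lim: "(\<lambda>m. \<Sum>i<m. a i) \<longlonglongrightarrow> w"
    unfolding w_def by (rule summable_LIMSEQ[OF summable_norm_cancel[OF summ]])
  \<comment> \<open>The partial sums from \<open>Suc k\<close> on dominate \<open>a k\<close>, and
    the positive cone is closed.\<close>
  have aw: "a k \<le> w" for k
  proof -
    have "(\<lambda>m. (\<Sum>i<m. a i) - a k) \<longlonglongrightarrow> w - a k"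
      by (intro tendsto_intros a_lim)
    moreover have "\<forall>\<^sub>F m in sequentially. 0 \<le> (\<Sum>i<m. a i) - a k"
    proof (rule eventually_sequentiallyI)
      fix m assume "Suc k \<le> m"
      then have "a k \<le> (\<Sum>i<m. a i)"
        using a by (intro member_le_sum_nonneg) auto
      then show "0 \<le> (\<Sum>i<m. a i) - a k"
        by simp
    qed
    ultimately have "0 \<le> w - a k"
      by (rule nonneg_limit)
    then show ?thesis
      by simp
  qed
  have "norm w \<le> (\<Sum>k. norm (a k))"
    unfolding w_def by (rule summable_norm[OF summ])
  also have "\<dots> \<le> (\<Sum>k. (1 / 2) ^ k)"
    by (intro suminf_le a_norm summ) simp
  also have "\<dots> = 2"
    by (simp add: suminf_geometric)
  finally have "C * norm w \<le> C * 2"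
    using C by (intro mult_left_mono)
  show False
  proof (rule no_large_disjoint[where d = d and n = n and w = w and c = "\<lambda>k. 2 ^ k" and L = L and \<epsilon> = \<epsilon>])
    show "0 \<le> w"
      using a[of 0] aw[of 0] by (rule order_trans)
    show "C * norm w \<le> L * \<epsilon>"
      using \<open>C * norm w \<le> C * 2\<close> L(2) by (rule order_trans)
    fix k :: nat
    have "2 ^ k *\<^sub>R a k \<le> (2 ^ k :: real) *\<^sub>R w"
      by (intro scaleR_left_mono aw) simp
    then show "d k \<le> 2 ^ k *\<^sub>R w"
      by (simp add: a_def power_one_over)
    show "2 ^ k * L * dual_apply (f (n k)) (\<Sum>i<k. d i) \<le> \<epsilon>"
    proof (cases k)
      case 0
      then show ?thesis
        using \<epsilon> by (simp add: dual.zero_right)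
    next
      case (Suc j)
      then show ?thesis
        using S_small[of j] S_sum[of j] by simp
    qed
  qed (use d L \<epsilon> in auto)
qed

end


section \<open>L-weakly compact sets in a dual\<close>

lemma mem_sol_iff: "y \<in> sol A \<longleftrightarrow> (\<exists>a\<in>A. \<bar>y\<bar> \<le> \<bar>a\<bar>)"
proof -
  have "- \<bar>a\<bar> \<le> y \<and> y \<le> \<bar>a\<bar> \<longleftrightarrow> \<bar>y\<bar> \<le> \<bar>a\<bar>" for a :: 'a
    by (metis abs_ge_minus_self abs_ge_self abs_leI minus_le_iff order_trans)
  then show ?thesis
    by (auto simp: sol_def)
qed

text \<open>The free choice of \<open>h\<close> in \<open>null\<close> expresses uniform convergence
  on \<open>B\<close>. A disjoint sequence in \<open>sol B\<close> is dominated by moduli of members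
  of \<open>B\<close>, so it remains to pass from members to their moduli.\<close>

lemma Lwc_set_dualI:
  fixes B :: "'a::banach_lattice dual set"
  assumes "bounded B"
    and null: "\<And>x h. disjoint_seq x \<Longrightarrow> bounded (range x) \<Longrightarrow> (\<And>k. h k \<in> B) \<Longrightarrow>
      (\<lambda>k. dual_apply (h k) (x k)) \<longlonglongrightarrow> 0"
  shows "Lwc_set B"
  unfolding Lwc_set_def
proof (intro allI impI, elim conjE)
  fix f :: "nat \<Rightarrow> 'a dual" assume f: "disjoint_seq f" "range f \<subseteq> sol B"
  then have "\<exists>h\<in>B. \<bar>f k\<bar> \<le> \<bar>h\<bar>" for k
    unfolding mem_sol_iff[symmetric] by blast
  then obtain h where h: "\<And>k. h k \<in> B" "\<And>k. \<bar>f k\<bar> \<le> \<bar>h k\<bar>"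
    by metis
  obtain C where C: "\<And>g. g \<in> B \<Longrightarrow> norm g \<le> C"
    using assms(1) by (auto simp: bounded_iff)
  have "(\<lambda>k. norm \<bar>f k\<bar>) \<longlonglongrightarrow> 0"
  proof (rule disjoint_functionals_norm_null)
    show "norm \<bar>f k\<bar> \<le> C" for k
      using norm_mono_abs[OF h(2)[of k]] C[OF h(1)[of k]] by (simp add: norm_abs)
    show "inf \<bar>f i\<bar> \<bar>f j\<bar> = 0" if "i \<noteq> j" for i j
      using f(1) that by (simp add: disjoint_seq_def)
    fix x :: "nat \<Rightarrow> 'a" and n assume x: "disjoint_seq x" "\<And>k. 0 \<le> x k" "bounded (range x)"
    \<comment> \<open>By the Riesz-Kantorovich formula the modulus at \<open>x k\<close> is nearly
      attained by the functional itself at some \<open>w k\<close>; being dominated by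
      \<open>x k\<close>, these vectors remain disjoint and bounded.\<close>
    have "\<exists>w. \<bar>w\<bar> \<le> x k \<and> dual_apply \<bar>h (n k)\<bar> (x k) \<le> dual_apply (h (n k)) w + inverse (Suc k)" for k
    proof (rule ccontr)
      assume "\<not> ?thesis"
      then have "dual_apply \<bar>h (n k)\<bar> (x k) \<le> dual_apply \<bar>h (n k)\<bar> (x k) - inverse (Suc k)"
        by (intro abs_dual_least x) force
      then show False
        by simp
    qed
    then obtain w where w: "\<And>k. \<bar>w k\<bar> \<le> x k"
      "\<And>k. dual_apply \<bar>h (n k)\<bar> (x k) \<le> dual_apply (h (n k)) (w k) + inverse (Suc k)"
      by metis
    have "disjoint_seq w"
      unfolding disjoint_seq_def
    proof (intro allI impI)
      fix i j :: nat assume "i \<noteq> j"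
      then have "inf (x i) (x j) = 0"
        using x(1) by (simp add: disjoint_seq_def abs_of_nonneg x(2))
      then show "inf \<bar>w i\<bar> \<bar>w j\<bar> = 0"
        by (rule disjoint_mono[OF _ abs_ge_zero w(1) abs_ge_zero w(1)])
    qed
    moreover have "bounded (range w)"
    proof -
      obtain b where b: "\<And>k. norm (x k) \<le> b"
        using x(3) by (auto simp: bounded_iff)
      have "norm (w k) \<le> b" for k
        using norm_mono_nonneg[OF abs_ge_zero w(1)[of k]] b[of k] by (simp add: norm_abs)
      then show ?thesis
        by (auto simp: bounded_iff)
    qed
    ultimately have "(\<lambda>k. dual_apply (h (n k)) (w k)) \<longlonglongrightarrow> 0"
      using h(1) by (intro null)
    then have lim: "(\<lambda>k. dual_apply (h (n k)) (w k) + inverse (Suc k)) \<longlonglongrightarrow> 0"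
      using tendsto_add[OF _ LIMSEQ_inverse_real_of_nat] by fastforce
    show "(\<lambda>k. dual_apply \<bar>f (n k)\<bar> (x k)) \<longlonglongrightarrow> 0"
    proof (rule tendsto_sandwich[OF _ _ tendsto_const lim])
      show "\<forall>\<^sub>F k in sequentially. 0 \<le> dual_apply \<bar>f (n k)\<bar> (x k)"
        by (intro always_eventually allI dual_apply_nonneg abs_ge_zero x(2))
      have "dual_apply \<bar>f (n k)\<bar> (x k) \<le> dual_apply (h (n k)) (w k) + inverse (Suc k)" for k
        using dual_apply_mono_fun[OF h(2) x(2)] w(2) by (rule order_trans)
      then show "\<forall>\<^sub>F k in sequentially. dual_apply \<bar>f (n k)\<bar> (x k)
          \<le> dual_apply (h (n k)) (w k) + inverse (Suc k)"
        by (intro always_eventually allI)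
    qed
  qed (rule abs_ge_zero)
  then show "f \<longlonglongrightarrow> 0"
    by (simp add: norm_abs tendsto_norm_zero_iff)
qed


section \<open>Limited sets\<close>

lemma limited_set_tendsto:
  assumes A: "limited_set A" "\<And>k. a k \<in> A" and \<phi>: "weak_star_null \<phi>"
  shows "(\<lambda>k. dual_apply (\<phi> k) (a k)) \<longlonglongrightarrow> 0"
proof -
  have lim: "(\<lambda>k. SUP x\<in>A. ennreal \<bar>dual_apply (\<phi> k) x\<bar>) \<longlonglongrightarrow> 0"
    using A(1) \<phi> by (simp add: limited_set_def)
  have "(\<lambda>k. ennreal \<bar>dual_apply (\<phi> k) (a k)\<bar>) \<longlonglongrightarrow> ennreal 0"
    unfolding ennreal_0
  proof (rule tendsto_sandwich[OF _ _ tendsto_const lim])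
    show "\<forall>\<^sub>F k in sequentially. ennreal \<bar>dual_apply (\<phi> k) (a k)\<bar> \<le> (SUP x\<in>A. ennreal \<bar>dual_apply (\<phi> k) x\<bar>)"
      using A(2) by (intro always_eventually allI SUP_upper)
  qed simp
  then have "(\<lambda>k. \<bar>dual_apply (\<phi> k) (a k)\<bar>) \<longlonglongrightarrow> 0"
    by (rule tendsto_ennrealD) auto
  then show ?thesis
    by (rule tendsto_rabs_zero_cancel)
qed

lemma limited_set_singleton:
  fixes a :: "'a::banach"
  shows "limited_set {a}"
  unfolding limited_set_def
proof (intro conjI allI impI)
  fix \<phi> :: "nat \<Rightarrow> 'a dual" assume "weak_star_null \<phi>"
  then have "(\<lambda>k. \<bar>dual_apply (\<phi> k) a\<bar>) \<longlonglongrightarrow> 0"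
    by (simp add: weak_star_null_def tendsto_rabs_zero)
  then have "(\<lambda>k. ennreal \<bar>dual_apply (\<phi> k) a\<bar>) \<longlonglongrightarrow> ennreal 0"
    by (rule tendsto_ennrealI)
  then show "(\<lambda>k. SUP x\<in>{a}. ennreal \<bar>dual_apply (\<phi> k) x\<bar>) \<longlonglongrightarrow> 0"
    by simp
qed simp

text \<open>The canonical image of \<open>x\<close> in the bidual.\<close>

lemma ex_evaluation: "\<exists>\<phi>. \<forall>f. dual_apply \<phi> f = dual_apply f x"
  using ex_dual[OF dual.bounded_linear_left[of x]] by (auto dest: fun_cong)

lemma weakly_null_imp_weak_star_null:
  fixes f :: "nat \<Rightarrow> 'a::real_normed_vector dual"
  assumes "weakly_null f"
  shows "weak_star_null f"
  unfolding weak_star_null_def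
proof
  fix x :: 'a
  obtain \<phi> :: "'a dual dual" where \<phi>: "\<forall>g. dual_apply \<phi> g = dual_apply g x"
    using ex_evaluation[of x] by (rule exE)
  have "(\<lambda>n. dual_apply \<phi> (f n)) \<longlonglongrightarrow> 0"
    using assms by (simp add: weakly_null_def)
  then show "(\<lambda>n. dual_apply (f n) x) \<longlonglongrightarrow> 0"
    by (simp add: \<phi>)
qed

text \<open>Positive functionals norming the \<open>\<bar>y k\<bar>\<close> yield disjoint bounded
  \<open>h k\<close> with \<open>norm (y k) \<le> dual_apply (h k) (T (a k))\<close>. The adjoint
  maps these to a weak-star null sequence, which is uniformly small on the limited set
  \<open>A\<close>.\<close>

lemma limitedly_Lwc_if_adjoint_Mwc:
  fixes T :: "'x::banach \<Rightarrow>\<^sub>L 'f::banach_lattice"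
  assumes T: "limitedly_Mwc (adjoint_op T)"
  shows "limitedly_Lwc T"
  unfolding limitedly_Lwc_def Lwc_set_def
proof (intro allI impI, elim conjE)
  fix A and y :: "nat \<Rightarrow> 'f" assume A: "limited_set A" and y: "disjoint_seq y" "range y \<subseteq> sol (blinfun_apply T ` A)"
  have "\<exists>a\<in>A. \<bar>y k\<bar> \<le> \<bar>T a\<bar>" for k
    using subsetD[OF y(2) rangeI, of k] unfolding mem_sol_iff by blast
  then obtain a where a: "\<And>k. a k \<in> A" "\<And>k. \<bar>y k\<bar> \<le> \<bar>T (a k)\<bar>"
    by metis
  have "\<exists>g. 0 \<le> g \<and> norm g \<le> 1 \<and> dual_apply g \<bar>y k\<bar> = norm (y k)" for k
    using ex_norming_functional[OF abs_ge_zero, of "y k"] unfolding norm_abs by metis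
  then obtain g where g: "\<And>k. 0 \<le> g k" "\<And>k. norm (g k) \<le> 1"
    "\<And>k. dual_apply (g k) \<bar>y k\<bar> = norm (y k)"
    by metis
  obtain h where h: "\<And>k. \<bar>h k\<bar> \<le> g k" "disjoint_seq h"
    "\<And>k. dual_apply (g k) (inf \<bar>T (a k)\<bar> \<bar>y k\<bar>) \<le> dual_apply (h k) (T (a k))"
    using ex_disjoint_functionals[where g = g and z = "\<lambda>k. T (a k)", OF g(1) y(1)] by blast
  have "norm (h k) \<le> 1" for k
    using norm_mono_nonneg[OF abs_ge_zero h(1)[of k]] g(2)[of k] by (simp add: norm_abs)
  then have "bounded (range h)"
    by (auto simp: bounded_iff)
  then have wsn: "weak_star_null (\<lambda>k. adjoint_op T (h k))"
    using T h(2) by (intro weakly_null_imp_weak_star_null) (simp add: limitedly_Mwc_def)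
  have lim: "(\<lambda>k. dual_apply (h k) (T (a k))) \<longlonglongrightarrow> 0"
    using limited_set_tendsto[of A a, OF A a(1) wsn] by simp
  have "norm (y k) \<le> dual_apply (h k) (T (a k))" for k
    using h(3)[of k] g(3)[of k] by (simp add: inf_absorb2 a(2))
  then have "(\<lambda>k. norm (y k)) \<longlonglongrightarrow> 0"
    by (intro tendsto_sandwich[OF _ _ tendsto_const lim] always_eventually allI norm_ge_zero)
  then show "y \<longlonglongrightarrow> 0"
    by (rule tendsto_norm_zero_cancel)
qed

text \<open>Singletons are limited, so the image \<open>h\<close> of \<open>g\<close> under the
  adjoint forms an Lwc set. The functionals extracted from \<open>\<bar>h\<bar>\<close> along the
  disjoint \<open>x k\<close> lie in its solid hull, so they tend to 0 in norm, and they control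
  \<open>g\<close> at \<open>T (x k)\<close>.\<close>

lemma limitedly_Mwc_if_adjoint_Lwc:
  fixes T :: "'e::banach_lattice \<Rightarrow>\<^sub>L 'y::banach"
  assumes T: "limitedly_Lwc (adjoint_op T)"
  shows "limitedly_Mwc T"
  unfolding limitedly_Mwc_def weakly_null_def
proof (intro allI impI, elim conjE)
  fix x :: "nat \<Rightarrow> 'e" and g :: "'y dual" assume x: "disjoint_seq x" "bounded (range x)"
  define h where "h = adjoint_op T g"
  have Lwc: "Lwc_set {h}"
    using T limited_set_singleton[of g] by (auto simp: limitedly_Lwc_def h_def)
  \<comment> \<open>With \<open>\<bar>x k\<bar>\<close> as test vector the infimum is
    \<open>\<bar>x k\<bar>\<close> itself, so \<open>f k\<close> keeps the whole value of
    \<open>\<bar>h\<bar>\<close> there.\<close>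
  obtain f where f: "\<And>k. \<bar>f k\<bar> \<le> \<bar>h\<bar>" "disjoint_seq f"
    and fx: "\<And>k. dual_apply \<bar>h\<bar> (inf \<bar>\<bar>x k\<bar>\<bar> \<bar>x k\<bar>) \<le> dual_apply (f k) \<bar>x k\<bar>"
    using ex_disjoint_functionals[where g = "\<lambda>_. \<bar>h\<bar>" and z = "\<lambda>k. \<bar>x k\<bar>", OF abs_ge_zero x(1)]
    by blast
  have "f k \<in> sol {h}" for k
    using f(1) by (simp add: mem_sol_iff)
  then have "f \<longlonglongrightarrow> 0"
    using Lwc f(2) by (auto simp: Lwc_set_def)
  obtain C where C: "\<And>k. norm (x k) \<le> C"
    using x(2) by (auto simp: bounded_iff)
  have bound: "norm (dual_apply g (T (x k))) \<le> norm (f k) * C" for k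
  proof -
    have "\<bar>dual_apply h (x k)\<bar> \<le> dual_apply \<bar>h\<bar> \<bar>x k\<bar>"
      by (rule abs_dual_apply)
    also have "\<dots> \<le> dual_apply (f k) \<bar>x k\<bar>"
      using fx[of k] by simp
    also have "\<dots> \<le> norm (f k) * norm (x k)"
      using norm_dual_apply[of "f k" "\<bar>x k\<bar>"] by (simp add: norm_abs)
    also have "\<dots> \<le> norm (f k) * C"
      by (intro mult_left_mono C norm_ge_zero)
    finally show ?thesis
      by (simp add: h_def)
  qed
  have "(\<lambda>k. norm (f k) * C) \<longlonglongrightarrow> 0"
    using \<open>f \<longlonglongrightarrow> 0\<close> by (intro tendsto_mult_left_zero tendsto_norm_zero)
  then show "(\<lambda>k. dual_apply g (T (x k))) \<longlonglongrightarrow> 0"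
    by (rule Lim_null_comparison[rotated]) (intro always_eventually allI bound)
qed

text \<open>Weak convergence of \<open>T (x k)\<close> to 0 is weak-star convergence of the
  canonical images in the bidual, hence uniform on a limited set of functionals; this is the
  hypothesis of \<open>Lwc_set_dualI\<close>.\<close>

lemma adjoint_Lwc_if_limitedly_Mwc:
  fixes T :: "'e::banach_lattice \<Rightarrow>\<^sub>L 'y::banach"
  assumes T: "limitedly_Mwc T"
  shows "limitedly_Lwc (adjoint_op T)"
  unfolding limitedly_Lwc_def
proof (intro allI impI)
  fix A :: "'y dual set" assume A: "limited_set A"
  show "Lwc_set (blinfun_apply (adjoint_op T) ` A)"
  proof (rule Lwc_set_dualI)
    show "bounded (blinfun_apply (adjoint_op T) ` A)"
      using A by (intro bounded_linear_image blinfun.bounded_linear_right) (simp add: limited_set_def)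
    fix x :: "nat \<Rightarrow> 'e" and h :: "nat \<Rightarrow> 'e dual" assume x: "disjoint_seq x" "bounded (range x)"
      and "\<And>k. h k \<in> blinfun_apply (adjoint_op T) ` A"
    then have "\<exists>g\<in>A. h k = adjoint_op T g" for k
      by blast
    then obtain g where g: "\<And>k. g k \<in> A" "\<And>k. h k = adjoint_op T (g k)"
      by metis
    have null: "weakly_null (\<lambda>k. T (x k))"
      using T x by (simp add: limitedly_Mwc_def)
    have "\<forall>k :: nat. \<exists>\<phi>. \<forall>f. dual_apply \<phi> f = dual_apply f (T (x k))"
      by (intro allI ex_evaluation)
    then obtain \<phi> where \<phi>: "\<And>k f. dual_apply (\<phi> k) f = dual_apply f (T (x k))"
      unfolding choice_iff by blast
    have wsn: "weak_star_null \<phi>"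
      using null by (simp add: weak_star_null_def weakly_null_def \<phi>)
    show "(\<lambda>k. dual_apply (h k) (x k)) \<longlonglongrightarrow> 0"
      using limited_set_tendsto[of A g, OF A g(1) wsn] by (simp add: \<phi> g(2))
  qed
qed

theorem theorem2p14:
  shows "(\<forall>T :: 'x::banach \<Rightarrow>\<^sub>L 'f::banach_lattice.
            limitedly_Mwc (adjoint_op T) \<longrightarrow> limitedly_Lwc T) \<and>
         (\<forall>T :: 'e::banach_lattice \<Rightarrow>\<^sub>L 'y::banach.
            limitedly_Lwc (adjoint_op T) \<longleftrightarrow> limitedly_Mwc T)"
  using limitedly_Lwc_if_adjoint_Mwc limitedly_Mwc_if_adjoint_Lwc adjoint_Lwc_if_limitedly_Mwc
  by blast

end
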